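(* Let $G(p,q)\subset SO(3)$ be the group generated by $A=R_x^{2\pi/p}$ and $B=R_z^{2\pi/q}$. If $p\ge 4$ is even and $q\ge 3$ is odd, then $G(p,q)$ is isomorphic to the amalgamated free product $\mathbb{Z}_p *_{\mathbb{Z}_2} D_q$, where $\alpha^{p/2}\in\mathbb{Z}_p$ is identified with $\mu\in D_q$. If $p\ge 4$ is even and $q=2s$ with $s\ge 3$ odd, then $G(p,q)$ is isomorphic to the amalgamated free product $D_p *_{D_2} D_q$, where $\gamma\in D_p$ is identified with $\beta^{q/2}\in D_q$ and $\alpha^{p/2}\in D_p$ is identified with $\mu\in D_q$.
   Context: $R_x^{\theta}, R_z^{\theta}\in SO(3)$ denote the rotations of Euclidean 3-space by angle $\theta$ (right-hand rule) about the $x$- and $z$-axis respectively. $\mathbb{Z}_p=\langle\alpha:\alpha^p\rangle$ is the cyclic group of order $p$ with generator $\alpha$. $D_p=\langle\alpha,\gamma:\alpha^p,\gamma^2,\gamma\alpha\gamma\alpha\rangle$ is the dihedral group of order $2p$ with generators $\alpha,\gamma$, and $D_q=\langle\beta,\mu:\beta^q,\mu^2,\mu\beta\mu\beta\rangle$ is the dihedral group of order $2q$ with generators $\beta,\mu$. In the first product the amalgamated $\mathbb{Z}_2$ is generated by $\alpha^{p/2}$ in $\mathbb{Z}_p$ and by $\mu$ in $D_q$. In the second product the amalgamated $D_2$ is generated by $\gamma,\alpha^{p/2}$ in $D_p$ and by $\beta^{q/2},\mu$ in $D_q$. *)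

theory Defs
  imports "HOL-Analysis.Analysis" "HOL-Algebra.Generated_Groups"
begin

section \<open>Groups given by generators and relators\<close>

text \<open>A word is a list of letters; the letter \<open>(x, True)\<close> stands for the generator \<open>x\<close> and
  \<open>(x, False)\<close> for its formal inverse. The presented group consists of the words modulo insertion
  and deletion of relators and of pairs of mutually inverse adjacent letters.\<close>

type_synonym 'a word = "('a \<times> bool) list"

definition words :: "'a set \<Rightarrow> 'a word set" where
  "words X = lists (X \<times> UNIV)"

inductive word_eq :: "'a set \<Rightarrow> 'a word set \<Rightarrow> 'a word \<Rightarrow> 'a word \<Rightarrow> bool"
  for X :: "'a set" and R :: "'a word set" where
  refl: "w \<in> words X \<Longrightarrow> word_eq X R w w"
| sym: "word_eq X R v w \<Longrightarrow> word_eq X R w v"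
| trans: "word_eq X R u v \<Longrightarrow> word_eq X R v w \<Longrightarrow> word_eq X R u w"
| cancel: "u \<in> words X \<Longrightarrow> v \<in> words X \<Longrightarrow> x \<in> X \<Longrightarrow>
    word_eq X R (u @ [(x, b), (x, \<not> b)] @ v) (u @ v)"
| relator: "u \<in> words X \<Longrightarrow> v \<in> words X \<Longrightarrow> r \<in> R \<Longrightarrow> r \<in> words X \<Longrightarrow>
    word_eq X R (u @ r @ v) (u @ v)"

definition word_rel :: "'a set \<Rightarrow> 'a word set \<Rightarrow> ('a word \<times> 'a word) set" where
  "word_rel X R = {(v, w). word_eq X R v w}"

definition presented :: "'a set \<Rightarrow> 'a word set \<Rightarrow> 'a word set monoid" where
  "presented X R =
    \<lparr>carrier = words X // word_rel X R,
     monoid.mult = (\<lambda>U V. \<Union>u\<in>U. \<Union>v\<in>V. word_rel X R `` {u @ v}),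
     one = word_rel X R `` {[]}\<rparr>"

definition pgen :: "'a set \<Rightarrow> 'a word set \<Rightarrow> 'a \<Rightarrow> 'a word set" where
  "pgen X R x = word_rel X R `` {[(x, True)]}"

lemma word_eq_words: "word_eq X R v w \<Longrightarrow> v \<in> words X \<and> w \<in> words X"
  by (induction rule: word_eq.induct) (auto simp: words_def)

lemma equiv_word_rel: "equiv (words X) (word_rel X R)"
proof (rule equivI)
  show "word_rel X R \<subseteq> words X \<times> words X"
    using word_eq_words by (fastforce simp: word_rel_def)
  show "refl_on (words X) (word_rel X R)"
    by (auto simp: refl_on_def word_rel_def intro: word_eq.refl)
  show "sym (word_rel X R)"
    by (auto simp: sym_def word_rel_def intro: word_eq.sym)
  show "trans (word_rel X R)"
    by (auto simp: trans_def word_rel_def intro: word_eq.trans)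
qed

lemma word_eq_context:
  assumes "word_eq X R v w" "a \<in> words X" "b \<in> words X"
  shows "word_eq X R (a @ v @ b) (a @ w @ b)"
  using assms
proof (induction rule: word_eq.induct)
  case (refl w)
  then show ?case by (auto simp: words_def intro: word_eq.refl)
next
  case (sym v w)
  then show ?case by (blast intro: word_eq.sym)
next
  case (trans u v w)
  then show ?case by (blast intro: word_eq.trans)
next
  case (cancel u v x c)
  then show ?case
    using word_eq.cancel[of "a @ u" X "v @ b" x R c] by (simp add: words_def)
next
  case (relator u v r)
  then show ?case
    using word_eq.relator[of "a @ u" X "v @ b" r R] by (simp add: words_def)
qed

lemma word_eq_append:
  assumes "word_eq X R u u'" "word_eq X R v v'"
  shows "word_eq X R (u @ v) (u' @ v')"
proof -
  have "word_eq X R (u @ v) (u' @ v)"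
    using word_eq_context[OF assms(1), of "[]" v] word_eq_words[OF assms(2)]
    by (simp add: words_def)
  moreover have "word_eq X R (u' @ v) (u' @ v')"
    using word_eq_context[OF assms(2), of u' "[]"] word_eq_words[OF assms(1)]
    by (simp add: words_def)
  ultimately show ?thesis by (rule word_eq.trans)
qed

lemma presented_mult:
  assumes "u \<in> words X" "v \<in> words X"
  shows "(word_rel X R `` {u}) \<otimes>\<^bsub>presented X R\<^esub> (word_rel X R `` {v}) = word_rel X R `` {u @ v}"
proof -
  have "word_rel X R `` {u' @ v'} = word_rel X R `` {u @ v}"
    if "u' \<in> word_rel X R `` {u}" "v' \<in> word_rel X R `` {v}" for u' v'
    using that word_eq_append[of X R u u' v v'] equiv_class_eq[OF equiv_word_rel]
    by (fastforce simp: word_rel_def)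
  moreover have "u \<in> word_rel X R `` {u}" "v \<in> word_rel X R `` {v}"
    using assms by (auto simp: word_rel_def intro: word_eq.refl)
  ultimately have "(\<Union>u'\<in>word_rel X R `` {u}. \<Union>v'\<in>word_rel X R `` {v}. word_rel X R `` {u' @ v'})
      = word_rel X R `` {u @ v}"
    by blast
  then show ?thesis
    by (simp add: presented_def)
qed

definition word_inv :: "'a word \<Rightarrow> 'a word" where
  "word_inv w = rev (map (\<lambda>(x, b). (x, \<not> b)) w)"

lemma word_inv_words: "w \<in> words X \<Longrightarrow> word_inv w \<in> words X"
  by (auto simp: words_def word_inv_def lists_eq_set)

lemma word_inv_left: "w \<in> words X \<Longrightarrow> word_eq X R (word_inv w @ w) []"
proof (induction w)
  case Nil
  then show ?case by (simp add: word_inv_def word_eq.refl words_def)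
next
  case (Cons l w)
  obtain x b where l: "l = (x, b)" by force
  have x: "x \<in> X" and w: "w \<in> words X" using Cons.prems l by (auto simp: words_def)
  have "word_eq X R (word_inv w @ [(x, \<not> b), (x, \<not> \<not> b)] @ w) (word_inv w @ w)"
    using word_inv_words[OF w] w x by (rule word_eq.cancel)
  then show ?case
    using word_eq.trans Cons.IH[OF w] by (fastforce simp: l word_inv_def)
qed

lemma group_presented: "group (presented X R)"
proof (rule groupI)
  have cls: "word_rel X R `` {w} \<in> carrier (presented X R)" if "w \<in> words X" for w
    using that by (simp add: presented_def quotientI)
  have rep: "\<exists>w \<in> words X. U = word_rel X R `` {w}" if "U \<in> carrier (presented X R)" for U
    using that by (auto simp: presented_def quotient_def)
  have app: "u @ v \<in> words X" if "u \<in> words X" "v \<in> words X" for u v :: "'a word"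
    using that by (simp add: words_def)
  have nil: "[] \<in> words X" by (simp add: words_def)
  have one: "\<one>\<^bsub>presented X R\<^esub> = word_rel X R `` {[]}" by (simp add: presented_def)
  show "\<one>\<^bsub>presented X R\<^esub> \<in> carrier (presented X R)" using cls[OF nil] by (simp add: one)
  fix U assume "U \<in> carrier (presented X R)"
  then obtain u where u: "u \<in> words X" "U = word_rel X R `` {u}" using rep by blast
  show "\<one>\<^bsub>presented X R\<^esub> \<otimes>\<^bsub>presented X R\<^esub> U = U"
    using presented_mult[OF nil u(1)] by (simp add: one u)
  have "(word_rel X R `` {word_inv u}) \<otimes>\<^bsub>presented X R\<^esub> U = \<one>\<^bsub>presented X R\<^esub>"
    using presented_mult[OF word_inv_words[OF u(1)] u(1)] word_inv_left[OF u(1), of R]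
      equiv_class_eq[OF equiv_word_rel]
    by (fastforce simp: one u word_rel_def)
  then show "\<exists>V \<in> carrier (presented X R). V \<otimes>\<^bsub>presented X R\<^esub> U = \<one>\<^bsub>presented X R\<^esub>"
    using cls[OF word_inv_words[OF u(1)]] by blast
  fix V assume "V \<in> carrier (presented X R)"
  then obtain v where v: "v \<in> words X" "V = word_rel X R `` {v}" using rep by blast
  show "U \<otimes>\<^bsub>presented X R\<^esub> V \<in> carrier (presented X R)"
    using presented_mult u v cls app by metis
  fix W assume "W \<in> carrier (presented X R)"
  then obtain w where w: "w \<in> words X" "W = word_rel X R `` {w}" using rep by blast
  show "U \<otimes>\<^bsub>presented X R\<^esub> V \<otimes>\<^bsub>presented X R\<^esub> W = U \<otimes>\<^bsub>presented X R\<^esub> (V \<otimes>\<^bsub>presented X R\<^esub> W)"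
    by (simp add: u v w presented_mult app)
qed


section \<open>Cyclic and dihedral groups\<close>

definition cyc_rels :: "nat \<Rightarrow> unit word set" where
  "cyc_rels n = {replicate n ((), True)}"

definition cyc :: "nat \<Rightarrow> unit word set monoid" where
  "cyc n = presented UNIV (cyc_rels n)"

definition cyc_gen :: "nat \<Rightarrow> unit word set" where
  "cyc_gen n = pgen UNIV (cyc_rels n) ()"

datatype dih_letter = Rot | Refl

definition dih_rels :: "nat \<Rightarrow> dih_letter word set" where
  "dih_rels n =
    {replicate n (Rot, True),
     [(Refl, True), (Refl, True)],
     [(Refl, True), (Rot, True), (Refl, True), (Rot, True)]}"

definition dih :: "nat \<Rightarrow> dih_letter word set monoid" where
  "dih n = presented UNIV (dih_rels n)"

definition dih_rot :: "nat \<Rightarrow> dih_letter word set" where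
  "dih_rot n = pgen UNIV (dih_rels n) Rot"

definition dih_refl :: "nat \<Rightarrow> dih_letter word set" where
  "dih_refl n = pgen UNIV (dih_rels n) Refl"


section \<open>Amalgamated free products\<close>

text \<open>The free product of \<open>G\<close> and \<open>H\<close> (generated by the disjoint union of the carriers, subject to
  both multiplication tables) modulo the identification of \<open>f c\<close> with \<open>g c\<close> for all \<open>c\<close> in \<open>C\<close>.
  It is the free product with amalgamated subgroup \<open>C\<close> when \<open>f\<close> and \<open>g\<close> are injective
  homomorphisms from \<open>C\<close> to \<open>G\<close> and \<open>H\<close>.\<close>

definition amalgam_rels ::
  "('a, 'x) monoid_scheme \<Rightarrow> ('b, 'y) monoid_scheme \<Rightarrow> ('c, 'z) monoid_scheme \<Rightarrow>
   ('c \<Rightarrow> 'a) \<Rightarrow> ('c \<Rightarrow> 'b) \<Rightarrow> ('a + 'b) word set" where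
  "amalgam_rels G H C f g =
    {[(Inl x, True), (Inl y, True), (Inl (x \<otimes>\<^bsub>G\<^esub> y), False)] | x y. x \<in> carrier G \<and> y \<in> carrier G} \<union>
    {[(Inr x, True), (Inr y, True), (Inr (x \<otimes>\<^bsub>H\<^esub> y), False)] | x y. x \<in> carrier H \<and> y \<in> carrier H} \<union>
    {[(Inl (f c), True), (Inr (g c), False)] | c. c \<in> carrier C}"

definition amalgam ::
  "('a, 'x) monoid_scheme \<Rightarrow> ('b, 'y) monoid_scheme \<Rightarrow> ('c, 'z) monoid_scheme \<Rightarrow>
   ('c \<Rightarrow> 'a) \<Rightarrow> ('c \<Rightarrow> 'b) \<Rightarrow> ('a + 'b) word set monoid" where
  "amalgam G H C f g = presented (carrier G <+> carrier H) (amalgam_rels G H C f g)"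

lemma group_cyc: "group (cyc n)"
  and group_dih: "group (dih n)"
  and group_amalgam: "group (amalgam G H C f g)"
  by (simp_all add: cyc_def dih_def amalgam_def group_presented)


section \<open>Rotation groups\<close>

definition SO3 :: "(real ^ 3 ^ 3) monoid" where
  "SO3 = \<lparr>carrier = {M. rotation_matrix M}, monoid.mult = (**), one = mat 1\<rparr>"

text \<open>Matrices act on column vectors from the left.\<close>

definition Rx :: "real \<Rightarrow> real ^ 3 ^ 3" where
  "Rx t = vector [vector [1, 0, 0],
                  vector [0, cos t, - sin t],
                  vector [0, sin t, cos t]]"

definition Rz :: "real \<Rightarrow> real ^ 3 ^ 3" where
  "Rz t = vector [vector [cos t, - sin t, 0],
                  vector [sin t, cos t, 0],
                  vector [0, 0, 1]]"

definition rotgrp :: "nat \<Rightarrow> nat \<Rightarrow> (real ^ 3 ^ 3) monoid" where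
  "rotgrp p q = subgroup_generated SO3 {Rx (2 * pi / real p), Rz (2 * pi / real q)}"

lemma group_SO3: "group SO3"
proof (rule groupI)
  fix M assume M: "M \<in> carrier SO3"
  then have "transpose M \<in> carrier SO3"
    by (simp add: SO3_def rotation_matrix_def orthogonal_matrix_def)
  moreover have "transpose M \<otimes>\<^bsub>SO3\<^esub> M = \<one>\<^bsub>SO3\<^esub>"
    using M by (simp add: SO3_def rotation_matrix_def orthogonal_matrix_def)
  ultimately show "\<exists>N \<in> carrier SO3. N \<otimes>\<^bsub>SO3\<^esub> M = \<one>\<^bsub>SO3\<^esub>" by blast
qed (auto simp: SO3_def rotation_matrix_def orthogonal_matrix_mul det_mul
  orthogonal_matrix_id matrix_mul_assoc)

lemma Rx_in_SO3: "Rx t \<in> carrier SO3"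
proof -
  have "transpose (Rx t) ** Rx t = mat 1"
    using sin_cos_squared_add[of t]
    by (simp add: Rx_def vec_eq_iff forall_3 matrix_matrix_mult_def transpose_def sum_3 mat_def
        power2_eq_square)
  moreover have "det (Rx t) = 1"
    using sin_cos_squared_add[of t] by (simp add: Rx_def det_3 power2_eq_square)
  ultimately show ?thesis
    by (simp add: SO3_def rotation_matrix_def orthogonal_matrix)
qed

lemma Rz_in_SO3: "Rz t \<in> carrier SO3"
proof -
  have "transpose (Rz t) ** Rz t = mat 1"
    using sin_cos_squared_add[of t]
    by (simp add: Rz_def vec_eq_iff forall_3 matrix_matrix_mult_def transpose_def sum_3 mat_def
        power2_eq_square)
  moreover have "det (Rz t) = 1"
    using sin_cos_squared_add[of t] by (simp add: Rz_def det_3 power2_eq_square)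
  ultimately show ?thesis
    by (simp add: SO3_def rotation_matrix_def orthogonal_matrix)
qed

end

theory Submission
  imports Defs "HOL-Computational_Algebra.Polynomial"
begin

text \<open>Extend the 2-adic valuation \<open>v\<close> to the complex numbers. A root of unity \<open>w \<noteq> 1, - 1\<close> is never
  congruent to 1 modulo 2, so a rotation of finite order that is not a multiple of a quarter turn has
  \<open>v(cos) = v(sin) < 0\<close>. Hence in an alternating product of rotations about the two axes, applied to
  the first basis vector, every rotation about the z-axis strictly decreases the valuation of the first
  coordinate (the angles about the z-axis are not quarter turns because 4 does not divide \<open>q\<close>), while
  a rotation about the x-axis preserves this coordinate and, even if it is a quarter turn, leads back
  to a vector to which the next step applies. So such a product is not the identity; the half turns
  about the axes, which form the amalgamated subgroup, only change signs of coordinates.\<close>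

section \<open>Homomorphisms from presented groups\<close>

text \<open>No value group is built: v(x) \<ge> v(y) is read as divisibility of x by y in a
  valuation ring that contains the integers but not 1/2. The ring is found over the complex numbers
  because the congruence concerns roots of unity; the bridge to cosines is - e^(2it) = 1 - 2 cos t
  e^(it). Afterwards only its intersection with the reals is used. The obstacle is the quarter turn
  about the x-axis, which occurs when 4 divides p. It exchanges the second and third coordinates up
  to sign, so of the first two coordinates the first has the smaller valuation after a quarter turn,
  but the second after any other x-rotation. Hence the condition before a z-rotation is a
  disjunction. A presentation alone does not show that its relators leave the intended group.
  Faithful maps of the presented factors into SO(3) settle this and also explain the amalgamated
  subgroup: for p even, \<open>Rx pi\<close> is a power of A and inverts z-rotations, which produces
  D_q; for q even, \<open>Rz pi\<close> likewise enlarges Z_p to D_p, and the two half turns span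
  the common Klein four-group.\<close>

primrec word_eval :: "('b, 'm) monoid_scheme \<Rightarrow> ('a \<Rightarrow> 'b) \<Rightarrow> 'a word \<Rightarrow> 'b" where
  "word_eval K \<phi> [] = \<one>\<^bsub>K\<^esub>"
| "word_eval K \<phi> (l # w) =
    (if snd l then \<phi> (fst l) else inv\<^bsub>K\<^esub> (\<phi> (fst l))) \<otimes>\<^bsub>K\<^esub> word_eval K \<phi> w"

text \<open>The class is evaluated at an arbitrary representative;
  \<open>presented_hom_class\<close> gives independence of the choice once all relators evaluate to
  one.\<close>

definition presented_hom :: "('b, 'm) monoid_scheme \<Rightarrow> ('a \<Rightarrow> 'b) \<Rightarrow> 'a word set \<Rightarrow> 'b" where
  "presented_hom K \<phi> U = word_eval K \<phi> (SOME w. w \<in> U)"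

lemma words_simps [simp]:
  "[] \<in> words X"
  "(l # w) \<in> words X \<longleftrightarrow> fst l \<in> X \<and> w \<in> words X"
  "(v @ w) \<in> words X \<longleftrightarrow> v \<in> words X \<and> w \<in> words X"
  by (cases l; auto simp: words_def)+

lemma replicate_in_words [simp]: "x \<in> X \<Longrightarrow> replicate n (x, b) \<in> words X"
  by (induction n) auto

lemma (in group) word_eval_in_subgroup:
  assumes "subgroup S G" "\<phi> ` X \<subseteq> S" "w \<in> words X"
  shows "word_eval G \<phi> w \<in> S"
  using assms(3)
proof (induction w)
  case Nil
  then show ?case using subgroup.one_closed[OF assms(1)] by simp
next
  case (Cons l w)
  then have "\<phi> (fst l) \<in> S" "word_eval G \<phi> w \<in> S" using assms(2) by auto
  then show ?case
    using subgroup.m_closed[OF assms(1)] subgroup.m_inv_closed[OF assms(1)] by simp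
qed

lemma (in group) word_eval_closed:
  "\<phi> ` X \<subseteq> carrier G \<Longrightarrow> w \<in> words X \<Longrightarrow> word_eval G \<phi> w \<in> carrier G"
  using word_eval_in_subgroup[OF subgroup_self] by blast

lemma (in group) word_eval_append:
  assumes "\<phi> ` X \<subseteq> carrier G" "v \<in> words X" "w \<in> words X"
  shows "word_eval G \<phi> (v @ w) = word_eval G \<phi> v \<otimes> word_eval G \<phi> w"
  using assms(2)
proof (induction v)
  case Nil
  then show ?case using word_eval_closed[OF assms(1,3)] by simp
next
  case (Cons l v)
  then have "\<phi> (fst l) \<in> carrier G" using assms(1) by auto
  then show ?case
    using Cons word_eval_closed[OF assms(1)] assms(3) by (simp add: m_assoc)
qed

lemma (in group) word_eval_replicate:
  assumes "\<phi> x \<in> carrier G"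
  shows "word_eval G \<phi> (replicate n (x, True)) = \<phi> x [^] n"
proof (induction n)
  case (Suc n)
  then show ?case using assms nat_pow_mult[of "\<phi> x" 1 n] by simp
qed simp

text \<open>Each generating step of \<open>word_eq\<close> inserts or deletes a factor of value one.
  Only relators that are words over \<open>X\<close> matter, since the rule \<open>relator\<close>
  applies to no others.\<close>

lemma (in group) word_eval_cong:
  assumes \<phi>: "\<phi> ` X \<subseteq> carrier G"
    and R: "\<And>r. r \<in> R \<Longrightarrow> r \<in> words X \<Longrightarrow> word_eval G \<phi> r = \<one>"
    and "word_eq X R v w"
  shows "word_eval G \<phi> v = word_eval G \<phi> w"
  using assms(3)
proof (induction rule: word_eq.induct)
  case (cancel u v x b)
  have x: "\<phi> x \<in> carrier G" using cancel \<phi> by auto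
  have "word_eval G \<phi> ([(x, b), (x, \<not> b)] @ v) = word_eval G \<phi> v"
    using x word_eval_closed[OF \<phi> cancel(2)] by (simp add: m_assoc[symmetric])
  then show ?case
    using cancel by (subst (1 2) word_eval_append[OF \<phi>]) auto
next
  case (relator u v r)
  then show ?case
    by (simp add: word_eval_append[OF \<phi>] R word_eval_closed[OF \<phi>])
qed auto

lemma class_in_carrier: "w \<in> words X \<Longrightarrow> word_rel X R `` {w} \<in> carrier (presented X R)"
  by (simp add: presented_def quotientI)

lemma presented_cases:
  assumes "U \<in> carrier (presented X R)"
  obtains w where "w \<in> words X" "U = word_rel X R `` {w}"
  using assms by (auto simp: presented_def quotient_def)

lemma (in group) presented_hom_class:
  assumes \<phi>: "\<phi> ` X \<subseteq> carrier G"
    and R: "\<And>r. r \<in> R \<Longrightarrow> r \<in> words X \<Longrightarrow> word_eval G \<phi> r = \<one>"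
    and w: "w \<in> words X"
  shows "presented_hom G \<phi> (word_rel X R `` {w}) = word_eval G \<phi> w"
proof -
  have "w \<in> word_rel X R `` {w}" using w by (auto simp: word_rel_def intro: word_eq.refl)
  then have "(SOME v. v \<in> word_rel X R `` {w}) \<in> word_rel X R `` {w}" by (rule someI)
  then have "word_eq X R w (SOME v. v \<in> word_rel X R `` {w})" by (simp add: word_rel_def)
  then show ?thesis
    unfolding presented_hom_def using word_eval_cong[OF \<phi> R] by metis
qed

text \<open>Von Dyck's theorem: an assignment of generators that respects the relators extends to
  the presented group.\<close>

lemma (in group) presented_hom:
  assumes \<phi>: "\<phi> ` X \<subseteq> carrier G"
    and R: "\<And>r. r \<in> R \<Longrightarrow> r \<in> words X \<Longrightarrow> word_eval G \<phi> r = \<one>"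
  shows "presented_hom G \<phi> \<in> hom (presented X R) G"
    and "x \<in> X \<Longrightarrow> presented_hom G \<phi> (pgen X R x) = \<phi> x"
proof -
  note cls = presented_hom_class[OF assms]
  show "presented_hom G \<phi> \<in> hom (presented X R) G"
  proof (rule homI)
    fix U assume "U \<in> carrier (presented X R)"
    then obtain u where u: "u \<in> words X" "U = word_rel X R `` {u}" by (rule presented_cases)
    then show "presented_hom G \<phi> U \<in> carrier G" using cls word_eval_closed[OF \<phi>] by simp
    fix V assume "V \<in> carrier (presented X R)"
    then obtain v where v: "v \<in> words X" "V = word_rel X R `` {v}" by (rule presented_cases)
    show "presented_hom G \<phi> (U \<otimes>\<^bsub>presented X R\<^esub> V) = presented_hom G \<phi> U \<otimes> presented_hom G \<phi> V"
      using u v by (simp add: presented_mult cls word_eval_append[OF \<phi>])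
  qed
  assume "x \<in> X"
  then show "presented_hom G \<phi> (pgen X R x) = \<phi> x"
    using cls[where w = "[(x, True)]"] \<phi> by (auto simp: pgen_def)
qed

lemma pgen_in_carrier: "x \<in> X \<Longrightarrow> pgen X R x \<in> carrier (presented X R)"
  unfolding pgen_def by (rule class_in_carrier) simp

lemma pgen_inv:
  assumes "x \<in> X"
  shows "inv\<^bsub>presented X R\<^esub> (pgen X R x) = word_rel X R `` {[(x, False)]}"
proof -
  interpret P: group "presented X R" by (rule group_presented)
  have "word_eq X R ([] @ [(x, False), (x, \<not> False)] @ []) ([] @ [])"
    using assms by (intro word_eq.cancel) auto
  then have "word_rel X R `` {[(x, False), (x, True)]} = word_rel X R `` {[]}"
    by (intro equiv_class_eq[OF equiv_word_rel]) (simp add: word_rel_def)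
  then have "word_rel X R `` {[(x, False)]} \<otimes>\<^bsub>presented X R\<^esub> pgen X R x = \<one>\<^bsub>presented X R\<^esub>"
    using assms by (simp add: pgen_def presented_mult) (simp add: presented_def)
  then show ?thesis
    using assms by (intro P.inv_equality pgen_in_carrier class_in_carrier) auto
qed

lemma word_eval_presented:
  assumes "w \<in> words X"
  shows "word_eval (presented X R) (pgen X R) w = word_rel X R `` {w}"
  using assms
proof (induction w)
  case Nil
  then show ?case by (simp add: presented_def)
next
  case (Cons l w)
  obtain x b where l: "l = (x, b)" by force
  have "word_rel X R `` {[(x, b)]} \<otimes>\<^bsub>presented X R\<^esub> word_rel X R `` {w} = word_rel X R `` {(x, b) # w}"
    using Cons l presented_mult[of "[(x, b)]" X w R] by simp
  then show ?case using Cons l by (cases b) (auto simp: pgen_inv pgen_def[symmetric])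
qed

text \<open>Turns relators into equations between the generators inside the presented group, the
  form in which all later computations use them.\<close>

lemma word_eval_relator:
  assumes "r \<in> R" "r \<in> words X"
  shows "word_eval (presented X R) (pgen X R) r = \<one>\<^bsub>presented X R\<^esub>"
proof -
  have "word_eq X R ([] @ r @ []) ([] @ [])" using assms by (intro word_eq.relator) auto
  then have "word_rel X R `` {r} = word_rel X R `` {[]}"
    by (intro equiv_class_eq[OF equiv_word_rel]) (simp add: word_rel_def)
  then show ?thesis using assms(2) by (simp add: word_eval_presented) (simp add: presented_def)
qed

text \<open>Reduces a claim about all elements to closure under left multiplication by letters, as
  required for the normal forms below.\<close>

lemma presented_induct [consumes 1, case_names one gen inv]:
  assumes "U \<in> carrier (presented X R)"
    and one: "P \<one>\<^bsub>presented X R\<^esub>"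
    and gen: "\<And>x V. x \<in> X \<Longrightarrow> V \<in> carrier (presented X R) \<Longrightarrow> P V \<Longrightarrow>
      P (pgen X R x \<otimes>\<^bsub>presented X R\<^esub> V)"
    and inv: "\<And>x V. x \<in> X \<Longrightarrow> V \<in> carrier (presented X R) \<Longrightarrow> P V \<Longrightarrow>
      P (inv\<^bsub>presented X R\<^esub> (pgen X R x) \<otimes>\<^bsub>presented X R\<^esub> V)"
  shows "P U"
proof -
  interpret P: group "presented X R" by (rule group_presented)
  have "P (word_eval (presented X R) (pgen X R) w)" if "w \<in> words X" for w
    using that
  proof (induction w)
    case (Cons l w)
    then show ?case
      using gen inv P.word_eval_closed[of "pgen X R" X w] pgen_in_carrier[of _ X R]
      by (auto simp: image_subset_iff)
  qed (simp add: one)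
  then show ?thesis using assms(1) by (metis presented_cases word_eval_presented)
qed

lemma presented_hom_image:
  assumes "group K" "subgroup S K" "\<phi> ` X \<subseteq> S"
    and "\<And>r. r \<in> R \<Longrightarrow> r \<in> words X \<Longrightarrow> word_eval K \<phi> r = \<one>\<^bsub>K\<^esub>"
    and "U \<in> carrier (presented X R)"
  shows "presented_hom K \<phi> U \<in> S"
proof -
  interpret K: group K by fact
  have \<phi>: "\<phi> ` X \<subseteq> carrier K" using assms(2,3) subgroup.subset by blast
  show ?thesis
    using assms(5) K.presented_hom_class[OF \<phi> assms(4)] K.word_eval_in_subgroup[OF assms(2,3)]
    by (metis presented_cases)
qed


section \<open>Amalgamated products\<close>

lemma (in group) subgroup_mult_notin:
  assumes "subgroup S G" "c \<in> S" "x \<in> carrier G - S"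
  shows "c \<otimes> x \<in> carrier G - S" "x \<otimes> c \<in> carrier G - S"
proof -
  have c: "c \<in> carrier G" "inv c \<in> S"
    using assms subgroup.subset subgroup.m_inv_closed by auto
  then have "x = inv c \<otimes> (c \<otimes> x)" "x = (x \<otimes> c) \<otimes> inv c"
    using assms(3) by (simp_all add: m_assoc[symmetric]) (simp add: m_assoc)
  then show "c \<otimes> x \<in> carrier G - S" "x \<otimes> c \<in> carrier G - S"
    using assms c subgroup.m_closed[OF assms(1)] by (metis Diff_iff m_closed)+
qed

text \<open>The data of the universal property: homomorphisms out of both factors into
  \<open>K\<close> that agree on the amalgamated part. They induce \<open>\<Phi>\<close> on the
  amalgam.\<close>

locale amalgamated =
  G: group G + H: group H + C: group C + K: group K
  for G :: "('a, 'x) monoid_scheme" and H :: "('b, 'y) monoid_scheme"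
    and C :: "('c, 'z) monoid_scheme" and K :: "('k, 'w) monoid_scheme" +
  fixes f g \<rho> \<sigma>
  assumes f: "f \<in> hom C G" and g: "g \<in> hom C H"
    and \<rho>: "\<rho> \<in> hom G K" and \<sigma>: "\<sigma> \<in> hom H K"
    and compat: "\<And>c. c \<in> carrier C \<Longrightarrow> \<rho> (f c) = \<sigma> (g c)"
begin

abbreviation "\<Gamma> \<equiv> amalgam G H C f g"
abbreviation "X \<equiv> carrier G <+> carrier H"
abbreviation "R \<equiv> amalgam_rels G H C f g"

section \<open>Canonical maps into the amalgam and the induced homomorphism\<close>

definition inG :: "'a \<Rightarrow> ('a + 'b) word set" where "inG x = pgen X R (Inl x)"
definition inH :: "'b \<Rightarrow> ('a + 'b) word set" where "inH y = pgen X R (Inr y)"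

sublocale \<Gamma>: group \<Gamma> by (rule group_amalgam)

lemma f_closed [simp]: "c \<in> carrier C \<Longrightarrow> f c \<in> carrier G"
  and g_closed [simp]: "c \<in> carrier C \<Longrightarrow> g c \<in> carrier H"
  and \<rho>_closed [simp]: "x \<in> carrier G \<Longrightarrow> \<rho> x \<in> carrier K"
  and \<sigma>_closed [simp]: "y \<in> carrier H \<Longrightarrow> \<sigma> y \<in> carrier K"
  using f g \<rho> \<sigma> by (auto simp: hom_def)

lemma inG_closed [simp]: "x \<in> carrier G \<Longrightarrow> inG x \<in> carrier \<Gamma>"
  and inH_closed [simp]: "y \<in> carrier H \<Longrightarrow> inH y \<in> carrier \<Gamma>"
  unfolding inG_def inH_def amalgam_def by (auto intro: pgen_in_carrier)

lemma inG_hom: "inG \<in> hom G \<Gamma>"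
proof (rule homI)
  fix x y assume x: "x \<in> carrier G" and y: "y \<in> carrier G"
  then have "word_eval \<Gamma> (pgen X R)
      [(Inl x, True), (Inl y, True), (Inl (x \<otimes>\<^bsub>G\<^esub> y), False)] = \<one>\<^bsub>\<Gamma>\<^esub>"
    unfolding amalgam_def by (intro word_eval_relator) (auto simp: amalgam_rels_def)
  then have "(inG x \<otimes>\<^bsub>\<Gamma>\<^esub> inG y) \<otimes>\<^bsub>\<Gamma>\<^esub> inv\<^bsub>\<Gamma>\<^esub> (inG (x \<otimes>\<^bsub>G\<^esub> y)) = \<one>\<^bsub>\<Gamma>\<^esub>"
    using x y by (simp add: inG_def[symmetric] \<Gamma>.m_assoc)
  then show "inG (x \<otimes>\<^bsub>G\<^esub> y) = inG x \<otimes>\<^bsub>\<Gamma>\<^esub> inG y"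
    using x y by (metis G.m_closed \<Gamma>.inv_closed \<Gamma>.inv_equality \<Gamma>.inv_inv \<Gamma>.m_closed inG_closed)
qed simp

lemma inH_hom: "inH \<in> hom H \<Gamma>"
proof (rule homI)
  fix x y assume x: "x \<in> carrier H" and y: "y \<in> carrier H"
  then have "word_eval \<Gamma> (pgen X R)
      [(Inr x, True), (Inr y, True), (Inr (x \<otimes>\<^bsub>H\<^esub> y), False)] = \<one>\<^bsub>\<Gamma>\<^esub>"
    unfolding amalgam_def by (intro word_eval_relator) (auto simp: amalgam_rels_def)
  then have "(inH x \<otimes>\<^bsub>\<Gamma>\<^esub> inH y) \<otimes>\<^bsub>\<Gamma>\<^esub> inv\<^bsub>\<Gamma>\<^esub> (inH (x \<otimes>\<^bsub>H\<^esub> y)) = \<one>\<^bsub>\<Gamma>\<^esub>"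
    using x y by (simp add: inH_def[symmetric] \<Gamma>.m_assoc)
  then show "inH (x \<otimes>\<^bsub>H\<^esub> y) = inH x \<otimes>\<^bsub>\<Gamma>\<^esub> inH y"
    using x y by (metis H.m_closed \<Gamma>.inv_closed \<Gamma>.inv_equality \<Gamma>.inv_inv \<Gamma>.m_closed inH_closed)
qed simp

lemma inG_f: "c \<in> carrier C \<Longrightarrow> inG (f c) = inH (g c)"
proof -
  assume c: "c \<in> carrier C"
  then have "word_eval \<Gamma> (pgen X R) [(Inl (f c), True), (Inr (g c), False)] = \<one>\<^bsub>\<Gamma>\<^esub>"
    unfolding amalgam_def by (intro word_eval_relator) (auto simp: amalgam_rels_def)
  then have "inG (f c) \<otimes>\<^bsub>\<Gamma>\<^esub> inv\<^bsub>\<Gamma>\<^esub> (inH (g c)) = \<one>\<^bsub>\<Gamma>\<^esub>"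
    using c by (simp add: inG_def[symmetric] inH_def[symmetric])
  then show "inG (f c) = inH (g c)"
    using c by (metis \<Gamma>.inv_closed \<Gamma>.inv_equality \<Gamma>.inv_inv f_closed g_closed inG_closed inH_closed)
qed

sublocale G\<Gamma>: group_hom G \<Gamma> inG
  using inG_hom by unfold_locales
sublocale H\<Gamma>: group_hom H \<Gamma> inH
  using inH_hom by unfold_locales
sublocale \<rho>: group_hom G K \<rho>
  using \<rho> by unfold_locales
sublocale \<sigma>: group_hom H K \<sigma>
  using \<sigma> by unfold_locales
sublocale f: group_hom C G f
  using f by unfold_locales
sublocale g: group_hom C H g
  using g by unfold_locales

definition \<Phi> :: "('a + 'b) word set \<Rightarrow> 'k" where
  "\<Phi> = presented_hom K (case_sum \<rho> \<sigma>)"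

lemma relators_trivial:
  assumes "r \<in> R"
  shows "word_eval K (case_sum \<rho> \<sigma>) r = \<one>\<^bsub>K\<^esub>"
  using assms by (auto simp: amalgam_rels_def compat K.m_assoc[symmetric])

lemma case_sum_closed: "case_sum \<rho> \<sigma> ` X \<subseteq> carrier K"
  by auto

lemma \<Phi>_hom: "\<Phi> \<in> hom \<Gamma> K"
  unfolding \<Phi>_def amalgam_def
  using K.presented_hom(1)[OF case_sum_closed relators_trivial] .

sublocale \<Phi>: group_hom \<Gamma> K \<Phi>
  using \<Phi>_hom by unfold_locales

lemma \<Phi>_pgen: "z \<in> X \<Longrightarrow> \<Phi> (pgen X R z) = case_sum \<rho> \<sigma> z"
  unfolding \<Phi>_def by (intro K.presented_hom(2) case_sum_closed relators_trivial)

lemma \<Phi>_inG [simp]: "x \<in> carrier G \<Longrightarrow> \<Phi> (inG x) = \<rho> x"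
  and \<Phi>_inH [simp]: "y \<in> carrier H \<Longrightarrow> \<Phi> (inH y) = \<sigma> y"
  unfolding inG_def inH_def using \<Phi>_pgen[of "Inl x"] \<Phi>_pgen[of "Inr y"] by auto

lemma \<Phi>_image_subgroup:
  assumes "subgroup S K" "\<rho> ` carrier G \<subseteq> S" "\<sigma> ` carrier H \<subseteq> S" "\<gamma> \<in> carrier \<Gamma>"
  shows "\<Phi> \<gamma> \<in> S"
  unfolding \<Phi>_def using assms
  by (intro presented_hom_image[OF K.is_group, of S _ X R] relators_trivial)
     (auto simp: amalgam_def)

text \<open>Alternating products of letters outside the amalgamated subgroup, sorted by the factor
  of the leftmost letter. No coset representatives are fixed, so an element of the amalgamated
  subgroup can be merged into a neighbouring letter.\<close>

inductive_set startG :: "('a + 'b) word set set" and startH :: "('a + 'b) word set set" where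
  singleG: "x \<in> carrier G - f ` carrier C \<Longrightarrow> inG x \<in> startG"
| consG: "x \<in> carrier G - f ` carrier C \<Longrightarrow> \<gamma> \<in> startH \<Longrightarrow> inG x \<otimes>\<^bsub>\<Gamma>\<^esub> \<gamma> \<in> startG"
| singleH: "y \<in> carrier H - g ` carrier C \<Longrightarrow> inH y \<in> startH"
| consH: "y \<in> carrier H - g ` carrier C \<Longrightarrow> \<gamma> \<in> startG \<Longrightarrow> inH y \<otimes>\<^bsub>\<Gamma>\<^esub> \<gamma> \<in> startH"

lemma start_closed:
  "\<gamma> \<in> startG \<Longrightarrow> \<gamma> \<in> carrier \<Gamma>" "\<gamma> \<in> startH \<Longrightarrow> \<gamma> \<in> carrier \<Gamma>"
  by (induction rule: startG_startH.inducts) auto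

lemmas coset_f = G.subgroup_mult_notin(1)[OF f.img_is_subgroup imageI]
lemmas coset_g = H.subgroup_mult_notin(1)[OF g.img_is_subgroup imageI]

text \<open>Multiplying the leftmost letter by \<open>f c\<close> keeps it in its coset of the
  amalgamated subgroup, hence outside that subgroup.\<close>

lemma absorb_startG:
  assumes c: "c \<in> carrier C" and "\<gamma> \<in> startG"
  shows "inG (f c) \<otimes>\<^bsub>\<Gamma>\<^esub> \<gamma> \<in> startG"
  using assms(2)
proof cases
  case (singleG x)
  then show ?thesis
    using startG_startH.singleG[OF coset_f[OF c]] c by simp
next
  case (consG x \<delta>)
  then show ?thesis
    using startG_startH.consG[OF coset_f[OF c], of x \<delta>] c start_closed
    by (simp add: \<Gamma>.m_assoc)
qed

lemma absorb_startH:
  assumes c: "c \<in> carrier C" and "\<gamma> \<in> startH"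
  shows "inH (g c) \<otimes>\<^bsub>\<Gamma>\<^esub> \<gamma> \<in> startH"
  using assms(2)
proof cases
  case (singleH x)
  then show ?thesis
    using startG_startH.singleH[OF coset_g[OF c]] c by simp
next
  case (consH x \<delta>)
  then show ?thesis
    using startG_startH.consH[OF coset_g[OF c], of x \<delta>] c start_closed
    by (simp add: \<Gamma>.m_assoc)
qed

abbreviation "normal_forms \<equiv> inG ` f ` carrier C \<union> startG \<union> startH"

text \<open>A factor from the amalgamated subgroup is absorbed; any other is prepended to a product
  starting in \<open>H\<close>, or merged with a leftmost letter from \<open>G\<close>.\<close>

lemma inG_mult_normal:
  assumes x: "x \<in> carrier G" and \<gamma>: "\<gamma> \<in> normal_forms"
  shows "inG x \<otimes>\<^bsub>\<Gamma>\<^esub> \<gamma> \<in> normal_forms"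
proof (cases "x \<in> f ` carrier C")
  case True
  then obtain c where c: "c \<in> carrier C" "x = f c" by auto
  consider d where "d \<in> carrier C" "\<gamma> = inG (f d)" | "\<gamma> \<in> startG" | "\<gamma> \<in> startH"
    using \<gamma> by auto
  then show ?thesis
  proof cases
    case 1
    then have "inG x \<otimes>\<^bsub>\<Gamma>\<^esub> \<gamma> = inG (f (c \<otimes>\<^bsub>C\<^esub> d))" using c by simp
    then show ?thesis using 1 c by blast
  qed (use c absorb_startG absorb_startH inG_f in auto)
next
  case False
  then have x': "x \<in> carrier G - f ` carrier C" using x by simp
  consider d where "d \<in> carrier C" "\<gamma> = inG (f d)" | "\<gamma> \<in> startG" | "\<gamma> \<in> startH"
    using \<gamma> by auto
  then show ?thesis
  proof cases
    case 1
    have "inG (x \<otimes>\<^bsub>G\<^esub> f d) \<in> startG"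
      using G.subgroup_mult_notin(2)[OF f.img_is_subgroup imageI x', of d] 1 by (intro singleG) simp
    then show ?thesis using x 1 by simp
  next
    case 2
    then show ?thesis
    proof cases
      case (singleG y)
      then have eq: "inG x \<otimes>\<^bsub>\<Gamma>\<^esub> \<gamma> = inG (x \<otimes>\<^bsub>G\<^esub> y)" using x by simp
      show ?thesis
      proof (cases "x \<otimes>\<^bsub>G\<^esub> y \<in> f ` carrier C")
        case True
        then obtain c where "c \<in> carrier C" "x \<otimes>\<^bsub>G\<^esub> y = f c" by auto
        then show ?thesis using eq by auto
      next
        case False
        then show ?thesis using startG_startH.singleG[of "x \<otimes>\<^bsub>G\<^esub> y"] singleG x eq by auto
      qed
    next
      case (consG y \<delta>)
      then have eq: "inG x \<otimes>\<^bsub>\<Gamma>\<^esub> \<gamma> = inG (x \<otimes>\<^bsub>G\<^esub> y) \<otimes>\<^bsub>\<Gamma>\<^esub> \<delta>"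
        using x start_closed by (simp add: \<Gamma>.m_assoc)
      show ?thesis
      proof (cases "x \<otimes>\<^bsub>G\<^esub> y \<in> f ` carrier C")
        \<comment> \<open>The merged letter has dropped into the amalgamated subgroup; read as an
          element of \<open>H\<close> through \<open>inG_f\<close>, it is absorbed by
          \<open>\<delta>\<close>, which starts in \<open>H\<close>.\<close>
        case True
        then obtain c where "c \<in> carrier C" "x \<otimes>\<^bsub>G\<^esub> y = f c" by auto
        then show ?thesis using absorb_startH consG eq inG_f by auto
      next
        case False
        then show ?thesis using startG_startH.consG[of "x \<otimes>\<^bsub>G\<^esub> y" \<delta>] consG x eq by auto
      qed
    qed
  qed (use x' consG in auto)
qed

lemma inH_mult_normal:
  assumes x: "x \<in> carrier H" and \<gamma>: "\<gamma> \<in> normal_forms"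
  shows "inH x \<otimes>\<^bsub>\<Gamma>\<^esub> \<gamma> \<in> normal_forms"
proof (cases "x \<in> g ` carrier C")
  case True
  then obtain c where "c \<in> carrier C" "x = g c" by auto
  then show ?thesis using inG_mult_normal[of "f c" \<gamma>] \<gamma> by (simp add: inG_f)
next
  case False
  then have x': "x \<in> carrier H - g ` carrier C" using x by simp
  consider d where "d \<in> carrier C" "\<gamma> = inH (g d)" | "\<gamma> \<in> startG" | "\<gamma> \<in> startH"
    using \<gamma> inG_f by auto
  then show ?thesis
  proof cases
    case 1
    have "inH (x \<otimes>\<^bsub>H\<^esub> g d) \<in> startH"
      using H.subgroup_mult_notin(2)[OF g.img_is_subgroup imageI x', of d] 1 by (intro singleH) simp
    then show ?thesis using x 1 by simp
  next
    case 3
    then show ?thesis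
    proof cases
      case (singleH y)
      then have eq: "inH x \<otimes>\<^bsub>\<Gamma>\<^esub> \<gamma> = inH (x \<otimes>\<^bsub>H\<^esub> y)" using x by simp
      show ?thesis
      proof (cases "x \<otimes>\<^bsub>H\<^esub> y \<in> g ` carrier C")
        case True
        then obtain c where "c \<in> carrier C" "x \<otimes>\<^bsub>H\<^esub> y = g c" by auto
        then show ?thesis using eq inG_f[of c, symmetric] by auto
      next
        case False
        then show ?thesis using startG_startH.singleH[of "x \<otimes>\<^bsub>H\<^esub> y"] singleH x eq by auto
      qed
    next
      case (consH y \<delta>)
      then have eq: "inH x \<otimes>\<^bsub>\<Gamma>\<^esub> \<gamma> = inH (x \<otimes>\<^bsub>H\<^esub> y) \<otimes>\<^bsub>\<Gamma>\<^esub> \<delta>"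
        using x start_closed by (simp add: \<Gamma>.m_assoc)
      show ?thesis
      proof (cases "x \<otimes>\<^bsub>H\<^esub> y \<in> g ` carrier C")
        case True
        then obtain c where "c \<in> carrier C" "x \<otimes>\<^bsub>H\<^esub> y = g c" by auto
        then show ?thesis using absorb_startG consH eq inG_f[of c, symmetric] by auto
      next
        case False
        then show ?thesis using startG_startH.consH[of "x \<otimes>\<^bsub>H\<^esub> y" \<delta>] consH x eq by auto
      qed
    qed
  qed (use x' consH in auto)
qed

text \<open>The normal forms contain one and are closed under left multiplication by the generators
  and their inverses.\<close>

lemma all_normal:
  assumes "\<gamma> \<in> carrier \<Gamma>"
  shows "\<gamma> \<in> normal_forms"
proof -
  have "\<gamma> \<in> carrier (presented X R)" using assms by (simp add: amalgam_def)
  then show ?thesis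
  proof (induction rule: presented_induct)
    case one
    have "\<one>\<^bsub>\<Gamma>\<^esub> = inG (f \<one>\<^bsub>C\<^esub>)" by simp
    then show ?case using C.one_closed unfolding amalgam_def by blast
  next
    case (gen x V)
    consider y where "y \<in> carrier G" "x = Inl y" | y where "y \<in> carrier H" "x = Inr y"
      using gen(1) by auto
    then show ?case
      using inG_mult_normal[OF _ gen(3)] inH_mult_normal[OF _ gen(3)]
      by cases (simp_all only: amalgam_def[symmetric] inG_def[symmetric] inH_def[symmetric])
  next
    case (inv x V)
    consider y where "y \<in> carrier G" "x = Inl y" | y where "y \<in> carrier H" "x = Inr y"
      using inv(1) by auto
    then show ?case
    proof cases
      case (1 y)
      then have "inv\<^bsub>presented X R\<^esub> (pgen X R x) = inG (inv\<^bsub>G\<^esub> y)"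
        using G\<Gamma>.hom_inv[of y] by (simp add: amalgam_def inG_def)
      then show ?thesis
        using inG_mult_normal[of "inv\<^bsub>G\<^esub> y" V] 1 inv(3) by (simp only: amalgam_def G.inv_closed)
    next
      case (2 y)
      then have "inv\<^bsub>presented X R\<^esub> (pgen X R x) = inH (inv\<^bsub>H\<^esub> y)"
        using H\<Gamma>.hom_inv[of y] by (simp add: amalgam_def inH_def)
      then show ?thesis
        using inH_mult_normal[of "inv\<^bsub>H\<^esub> y" V] 2 inv(3) by (simp only: amalgam_def H.inv_closed)
    qed
  qed
qed

text \<open>A ping-pong criterion: \<open>P\<close> is meant to hold for the images of the alternating products
  that start in \<open>H\<close>.\<close>

theorem \<Phi>_inj:
  assumes inj: "inj_on \<rho> (carrier G)"
    and one: "\<And>y. y \<in> carrier H - g ` carrier C \<Longrightarrow> P (\<sigma> y)"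
    and two: "\<And>x y. x \<in> carrier G - f ` carrier C \<Longrightarrow> y \<in> carrier H - g ` carrier C \<Longrightarrow>
      P (\<sigma> y \<otimes>\<^bsub>K\<^esub> \<rho> x)"
    and step: "\<And>x y k. x \<in> carrier G - f ` carrier C \<Longrightarrow> y \<in> carrier H - g ` carrier C \<Longrightarrow>
      k \<in> carrier K \<Longrightarrow> P k \<Longrightarrow> P (\<sigma> y \<otimes>\<^bsub>K\<^esub> (\<rho> x \<otimes>\<^bsub>K\<^esub> k))"
    and nontriv: "\<And>k. k \<in> carrier K \<Longrightarrow> P k \<Longrightarrow> k \<noteq> \<one>\<^bsub>K\<^esub>"
    and nontriv': "\<And>x k. x \<in> carrier G - f ` carrier C \<Longrightarrow> k \<in> carrier K \<Longrightarrow> P k \<Longrightarrow>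
      \<rho> x \<otimes>\<^bsub>K\<^esub> k \<noteq> \<one>\<^bsub>K\<^esub>"
  shows "inj_on \<Phi> (carrier \<Gamma>)"
proof -
  \<comment> \<open>The possible images of a product starting in \<open>G\<close>: a single letter,
    or a letter followed by the image of a product starting in \<open>H\<close>.\<close>
  let ?Q = "\<lambda>k. \<exists>x \<in> carrier G - f ` carrier C. k = \<rho> x \<or>
    (\<exists>l \<in> carrier K. P l \<and> k = \<rho> x \<otimes>\<^bsub>K\<^esub> l)"
  have start: "\<gamma> \<in> startG \<Longrightarrow> ?Q (\<Phi> \<gamma>)" "\<gamma> \<in> startH \<Longrightarrow> P (\<Phi> \<gamma>)" for \<gamma>
  proof (induction rule: startG_startH.inducts)
    case (singleG x)
    then show ?case by auto
  next
    case (consG x \<gamma>)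
    then have "\<Phi> (inG x \<otimes>\<^bsub>\<Gamma>\<^esub> \<gamma>) = \<rho> x \<otimes>\<^bsub>K\<^esub> \<Phi> \<gamma>" "\<Phi> \<gamma> \<in> carrier K"
      using start_closed by auto
    then show ?case using consG by blast
  next
    case (singleH y)
    then show ?case using one by simp
  next
    case (consH y \<gamma>)
    then have "\<Phi> (inH y \<otimes>\<^bsub>\<Gamma>\<^esub> \<gamma>) = \<sigma> y \<otimes>\<^bsub>K\<^esub> \<Phi> \<gamma>"
      using start_closed by auto
    then show ?case using consH two step by auto
  qed
  have G1: "x = \<one>\<^bsub>G\<^esub>" if "x \<in> carrier G" "\<rho> x = \<one>\<^bsub>K\<^esub>" for x
    using inj_onD[OF inj, of x "\<one>\<^bsub>G\<^esub>"] that by simp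
  have "\<gamma> = \<one>\<^bsub>\<Gamma>\<^esub>" if \<gamma>: "\<gamma> \<in> carrier \<Gamma>" "\<Phi> \<gamma> = \<one>\<^bsub>K\<^esub>" for \<gamma>
  proof -
    consider d where "d \<in> carrier C" "\<gamma> = inG (f d)" | "\<gamma> \<in> startG" | "\<gamma> \<in> startH"
      using all_normal[OF \<gamma>(1)] by auto
    then show ?thesis
    proof cases
      case 1
      then have "f d = \<one>\<^bsub>G\<^esub>" using \<gamma> G1 by simp
      then show ?thesis using 1 by simp
    next
      case 2
      have "\<one>\<^bsub>G\<^esub> \<in> f ` carrier C" using f.hom_one C.one_closed by (metis imageI)
      obtain x where x: "x \<in> carrier G - f ` carrier C"
        and "\<Phi> \<gamma> = \<rho> x \<or> (\<exists>l \<in> carrier K. P l \<and> \<Phi> \<gamma> = \<rho> x \<otimes>\<^bsub>K\<^esub> l)"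
        using start(1)[OF 2] by blast
      \<comment> \<open>The longer form is excluded by \<open>nontriv'\<close>. A single letter with
        trivial image would be one by injectivity of \<open>\<rho>\<close>, yet one lies in the
        amalgamated subgroup.\<close>
      then have "\<rho> x = \<one>\<^bsub>K\<^esub>" using \<gamma>(2) nontriv'[OF x] by metis
      then have "x = \<one>\<^bsub>G\<^esub>" using x G1 by blast
      then show ?thesis using x \<open>\<one>\<^bsub>G\<^esub> \<in> f ` carrier C\<close> by blast
    next
      case 3
      then show ?thesis using start(2)[OF 3] \<gamma> nontriv[of "\<Phi> \<gamma>"] \<Phi>.hom_closed by metis
    qed
  qed
  then have "kernel \<Gamma> K \<Phi> = {\<one>\<^bsub>\<Gamma>\<^esub>}"
    unfolding kernel_def using \<Phi>.hom_one \<Gamma>.one_closed by blast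
  then show ?thesis by (rule \<Phi>.trivial_ker_imp_inj)
qed

end


section \<open>A valuation ring above 2\<close>

definition subring_of_field :: "'a::field set \<Rightarrow> bool" where
  "subring_of_field R \<longleftrightarrow> 1 \<in> R \<and> (\<forall>x\<in>R. \<forall>y\<in>R. x - y \<in> R \<and> x * y \<in> R)"

lemma subring_closed:
  assumes "subring_of_field R"
  shows "1 \<in> R" "0 \<in> R" "x \<in> R \<Longrightarrow> - x \<in> R"
    "x \<in> R \<Longrightarrow> y \<in> R \<Longrightarrow> x - y \<in> R"
    "x \<in> R \<Longrightarrow> y \<in> R \<Longrightarrow> x + y \<in> R"
    "x \<in> R \<Longrightarrow> y \<in> R \<Longrightarrow> x * y \<in> R"
proof -
  show one: "1 \<in> R" and diff: "x \<in> R \<Longrightarrow> y \<in> R \<Longrightarrow> x - y \<in> R"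
    and "x \<in> R \<Longrightarrow> y \<in> R \<Longrightarrow> x * y \<in> R" for x y
    using assms by (auto simp: subring_of_field_def)
  show zero: "0 \<in> R" using diff[OF one one] by simp
  show minus: "x \<in> R \<Longrightarrow> - x \<in> R" for x using diff[OF zero, of x] by simp
  show "x \<in> R \<Longrightarrow> y \<in> R \<Longrightarrow> x + y \<in> R" using diff[OF _ minus, of x y] by simp
qed

lemma subring_sum:
  assumes "subring_of_field R" "\<And>i. i \<in> A \<Longrightarrow> h i \<in> R"
  shows "sum h A \<in> R"
  using assms(2)
  by (induction A rule: infinite_finite_induct) (auto intro: subring_closed[OF assms(1)])

lemma subring_power:
  assumes "subring_of_field R" "x \<in> R"
  shows "x ^ n \<in> R"
  by (induction n) (auto intro: subring_closed[OF assms(1)] assms(2))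

text \<open>\<open>S\<close> is the ring R[\<alpha>]. As \<open>R\<close> is a set and not a type,
  its polynomials are those of the field with coefficients restricted to \<open>R\<close>.\<close>

lemma subring_adjoin:
  fixes \<alpha> :: "'a::field"
  assumes R: "subring_of_field R"
  defines "S \<equiv> {poly P \<alpha> | P. \<forall>i. coeff P i \<in> R}"
  shows "subring_of_field S" "R \<subseteq> S" "\<alpha> \<in> S"
proof -
  note [intro] = subring_closed[OF R]
  have "1 \<in> S"
    unfolding S_def by (rule CollectI, rule exI[of _ 1]) auto
  moreover have "x - y \<in> S \<and> x * y \<in> S" if "x \<in> S" "y \<in> S" for x y
  proof -
    from that obtain P Q where P: "x = poly P \<alpha>" "\<forall>i. coeff P i \<in> R"
      and Q: "y = poly Q \<alpha>" "\<forall>i. coeff Q i \<in> R" by (auto simp: S_def)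
    have "x - y = poly (P - Q) \<alpha>" "\<forall>i. coeff (P - Q) i \<in> R"
      using P Q by auto
    moreover have "x * y = poly (P * Q) \<alpha>" "\<forall>i. coeff (P * Q) i \<in> R"
      using P Q by (auto simp: coeff_mult intro!: subring_sum[OF R])
    ultimately show ?thesis unfolding S_def by blast
  qed
  ultimately show "subring_of_field S" by (auto simp: subring_of_field_def)
  show "R \<subseteq> S"
  proof
    fix x assume "x \<in> R"
    then have "x = poly [:x:] \<alpha> \<and> (\<forall>i. coeff [:x:] i \<in> R)"
      by (auto simp: coeff_pCons split: nat.split)
    then show "x \<in> S" unfolding S_def by blast
  qed
  have "\<alpha> = poly [:0, 1:] \<alpha> \<and> (\<forall>i. coeff [:0, 1::'a:] i \<in> R)"
    by (auto simp: coeff_pCons split: nat.split)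
  then show "\<alpha> \<in> S" unfolding S_def by blast
qed

text \<open>Let n be the degree of \<open>P\<close>, and p_n, q_0 the leading coefficient of
  \<open>P\<close> and the constant one of \<open>Q\<close>. The second relation times \<alpha>^n
  reads (1 - c q_0) \<alpha>^n = c T(\<alpha>) with \<open>T\<close> of degree below n. Scale the
  first relation by 1 - c q_0, replace its leading term accordingly, and add c q_0 to make the left
  side 1 again. Nothing is divided by 1 - c q_0.\<close>

lemma relation_reduce:
  fixes \<alpha> c :: "'a::field"
  assumes R: "subring_of_field R" and c: "c \<in> R" and \<alpha>: "\<alpha> \<noteq> 0"
    and P: "\<forall>i. coeff P i \<in> R" "1 = c * poly P \<alpha>"
    and Q: "\<forall>i. coeff Q i \<in> R" "1 = c * poly Q (inverse \<alpha>)"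
    and deg: "degree Q \<le> degree P" "0 < degree P"
  obtains P' where "\<forall>i. coeff P' i \<in> R" "1 = c * poly P' \<alpha>" "degree P' < degree P"
proof
  note [intro] = subring_closed[OF R]
  let ?n = "degree P" and ?m = "degree Q"
  \<comment> \<open>The tail of \<open>Q\<close> reversed, so that T(\<alpha>) = \<alpha>^n
    (Q(1/\<alpha>) - q_0). The exponents are true differences because the degree of \<open>Q\<close>
    is at most n.\<close>
  define T where "T = (\<Sum>j\<in>{1..?m}. monom (coeff Q j) (?n - j))"
  define P0 where "P0 = P - monom (coeff P ?n) ?n"
  define P' where "P' = [:coeff Q 0:] + smult (1 - c * coeff Q 0) P0 + smult (c * coeff P ?n) T"
  have T: "\<forall>i. coeff T i \<in> R"
    using Q by (auto simp: T_def coeff_sum intro!: subring_sum[OF R])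
  have P0: "\<forall>i. coeff P0 i \<in> R"
    using P by (auto simp: P0_def)
  have "coeff [:coeff Q 0:] i \<in> R" for i
    using Q by (auto simp: coeff_pCons split: nat.split)
  then show "\<forall>i. coeff P' i \<in> R"
    using T P0 P(1) Q(1) c by (simp add: P'_def subring_closed[OF R])
  have "degree T < ?n"
    unfolding T_def
  proof (rule degree_sum_less[OF _ deg(2)])
    fix j assume "j \<in> {1..?m}"
    then have "?n - j < ?n" using deg by auto
    then show "degree (monom (coeff Q j) (?n - j)) < ?n"
      using degree_monom_le[of "coeff Q j" "?n - j"] by linarith
  qed
  \<comment> \<open>The coefficient at n cancels, so the degree is at most n - 1, which is below n
    because n is positive.\<close>
  moreover have "degree P0 < ?n"
    unfolding P0_def using deg(2) degree_monom_le[of "coeff P ?n" ?n]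
    by (intro coeff_0_degree_minus_1[THEN le_less_trans] degree_diff_le) auto
  ultimately show "degree P' < ?n"
    unfolding P'_def using deg(2)
    by (intro degree_add_less) (auto intro: le_less_trans[OF degree_smult_le])
  have "poly T \<alpha> = (\<Sum>j\<in>{1..?m}. coeff Q j * \<alpha> ^ (?n - j))"
    by (simp add: T_def poly_sum poly_monom)
  also have "\<dots> = (\<Sum>j\<in>{1..?m}. coeff Q j * (inverse \<alpha>) ^ j) * \<alpha> ^ ?n"
    unfolding sum_distrib_right using deg \<alpha>
    by (intro sum.cong) (auto simp: power_diff power_inverse field_simps)
  also have "(\<Sum>j\<in>{1..?m}. coeff Q j * (inverse \<alpha>) ^ j) = poly Q (inverse \<alpha>) - coeff Q 0"
    unfolding poly_altdef by (simp add: atMost_atLeast0 sum.atLeast_Suc_atMost)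
  finally have "c * poly T \<alpha> = (1 - c * coeff Q 0) * \<alpha> ^ ?n"
    using Q(2) by (metis (no_types, opaque_lifting) mult.assoc right_diff_distrib)
  then have "c * poly P' \<alpha> = c * coeff Q 0 + (1 - c * coeff Q 0) * (c * poly P0 \<alpha>)
      + c * coeff P ?n * ((1 - c * coeff Q 0) * \<alpha> ^ ?n)"
    by (simp add: P'_def distrib_left mult_ac)
  also have "\<dots> = c * coeff Q 0 + (1 - c * coeff Q 0) * (c * poly P \<alpha>)"
    by (simp add: P0_def poly_monom algebra_simps)
  also have "\<dots> = 1" using P(2) by simp
  finally show "1 = c * poly P' \<alpha>" by simp
qed

text \<open>A subring maximal among those not containing \<open>1 / c\<close> is a valuation ring: otherwise both
  \<open>R[\<alpha>]\<close> and \<open>R[1 / \<alpha>]\<close> contain \<open>1 / c\<close>, and of two such relations of minimal degree one can be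
  used to shorten the other.\<close>

theorem valuation_ring_exists:
  fixes c :: "'a::field"
  assumes S: "subring_of_field S" and c: "c \<in> S" "inverse c \<notin> S"
  obtains R where "subring_of_field R" "S \<subseteq> R" "inverse c \<notin> R" "\<And>x. x \<in> R \<or> inverse x \<in> R"
proof -
  let ?A = "{R. subring_of_field R \<and> S \<subseteq> R \<and> inverse c \<notin> R}"
  have c0: "c \<noteq> 0" using c by auto
  have "\<exists>M\<in>?A. \<forall>X\<in>?A. M \<subseteq> X \<longrightarrow> X = M"
  proof (rule subset_Zorn_nonempty)
    show "?A \<noteq> {}" using assms by auto
    fix \<C> assume ne: "\<C> \<noteq> {}" and ch: "subset.chain ?A \<C>"
    have A: "R \<in> ?A" if "R \<in> \<C>" for R using ch that by (auto simp: subset.chain_def)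
    have "x - y \<in> \<Union>\<C> \<and> x * y \<in> \<Union>\<C>" if "x \<in> \<Union>\<C>" "y \<in> \<Union>\<C>" for x y
    proof -
      from that obtain B D where BD: "B \<in> \<C>" "D \<in> \<C>" "x \<in> B" "y \<in> D" by auto
      then have "B \<subseteq> D \<or> D \<subseteq> B" using ch by (auto simp: subset.chain_def)
      then obtain E where "E \<in> \<C>" "x \<in> E" "y \<in> E" using BD by blast
      then show ?thesis using A[of E] subring_closed(4,6)[of E x y] by auto
    qed
    moreover have "1 \<in> \<Union>\<C>" using ne A subring_closed(1) by fastforce
    ultimately show "\<Union>\<C> \<in> ?A" using ne A by (fastforce simp: subring_of_field_def)
  qed
  then obtain R where R: "subring_of_field R" "S \<subseteq> R" "inverse c \<notin> R"
    and max: "\<And>X. subring_of_field X \<Longrightarrow> R \<subseteq> X \<Longrightarrow> inverse c \<notin> X \<Longrightarrow> X = R"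
    by (smt (verit, ccfv_threshold) mem_Collect_eq order_trans)
  have cR: "c \<in> R" using c R by auto
  define rel where "rel \<alpha> P \<longleftrightarrow> (\<forall>i. coeff P i \<in> R) \<and> 1 = c * poly P \<alpha>" for \<alpha> P
  have rel: "\<exists>P. rel \<alpha> P" if "\<alpha> \<notin> R" for \<alpha>
  proof -
    let ?S = "{poly P \<alpha> | P. \<forall>i. coeff P i \<in> R}"
    have "subring_of_field ?S" "R \<subseteq> ?S" "\<alpha> \<in> ?S"
      by (rule subring_adjoin[OF R(1)])+
    \<comment> \<open>R[\<alpha>] is strictly larger than \<open>R\<close>, so by maximality it can
      fail only the condition of excluding 1 / c.\<close>
    then have "inverse c \<in> ?S"
      using max[of ?S] that by (metis (no_types, lifting))
    then show ?thesis unfolding rel_def using c0 by (auto simp: field_simps)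
  qed
  \<comment> \<open>A constant relation would put 1 / c into \<open>R\<close> itself.\<close>
  have pos: "0 < degree P" if "rel \<alpha> P" for \<alpha> P
  proof (rule ccontr)
    assume "\<not> 0 < degree P"
    then have "1 = c * coeff P 0" using that by (auto simp: rel_def elim: degree_eq_zeroE)
    then have "inverse c = coeff P 0" using c0 by (simp add: field_simps)
    then show False using R that by (simp add: rel_def)
  qed
  have "x \<in> R \<or> inverse x \<in> R" for x
  proof (rule ccontr)
    assume "\<not> (x \<in> R \<or> inverse x \<in> R)"
    then have x: "x \<notin> R" "inverse x \<notin> R" by auto
    then have x0: "x \<noteq> 0" using subring_closed(2)[OF R(1)] by auto
    obtain P where P: "rel x P" "\<And>P'. rel x P' \<Longrightarrow> degree P \<le> degree P'"
      using exists_least_iff[of "\<lambda>n. \<exists>P. rel x P \<and> degree P = n"] rel[OF x(1)]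
      by (metis not_less)
    obtain Q where Q: "rel (inverse x) Q" "\<And>Q'. rel (inverse x) Q' \<Longrightarrow> degree Q \<le> degree Q'"
      using exists_least_iff[of "\<lambda>n. \<exists>P. rel (inverse x) P \<and> degree P = n"] rel[OF x(2)]
      by (metis not_less)
    show False
    proof (cases "degree Q \<le> degree P")
      case True
      show False
      proof (rule relation_reduce[OF R(1) cR x0, of P Q])
        show "degree Q \<le> degree P" "0 < degree P" using True pos[OF P(1)] by simp_all
        show "\<forall>i. coeff P i \<in> R" "1 = c * poly P x"
          "\<forall>i. coeff Q i \<in> R" "1 = c * poly Q (inverse x)"
          using P(1) Q(1) by (simp_all add: rel_def)
        fix P' assume "\<forall>i. coeff P' i \<in> R" "1 = c * poly P' x" "degree P' < degree P"
        then show False using P(2)[of P'] by (simp add: rel_def)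
      qed
    next
      case False
      show False
      proof (rule relation_reduce[OF R(1) cR, of "inverse x" Q P])
        show "degree P \<le> degree Q" "0 < degree Q" "inverse x \<noteq> 0"
          using False x0 pos[OF Q(1)] by simp_all
        show "\<forall>i. coeff Q i \<in> R" "1 = c * poly Q (inverse x)"
          "\<forall>i. coeff P i \<in> R" "1 = c * poly P (inverse (inverse x))"
          using P(1) Q(1) by (simp_all add: rel_def)
        fix Q' assume "\<forall>i. coeff Q' i \<in> R" "1 = c * poly Q' (inverse x)" "degree Q' < degree Q"
        then show False using Q(2)[of Q'] by (simp add: rel_def)
      qed
    qed
  qed
  then show ?thesis using that R by blast
qed

locale valuation_ring =
  fixes V :: "'a::field set"
  assumes subring: "subring_of_field V"
    and valuation: "\<And>x. x \<in> V \<or> inverse x \<in> V"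
begin

section \<open>Comparison of valuations through divisibility\<close>

lemmas closed = subring_closed[OF subring]

text \<open>\<open>dom x y\<close>: the valuation of \<open>x\<close> is at least that of \<open>y\<close>.\<close>

definition dom :: "'a \<Rightarrow> 'a \<Rightarrow> bool" where
  "dom x y \<longleftrightarrow> (\<exists>r\<in>V. x = r * y)"

lemma dom_refl [simp]: "dom x x"
  using closed(1) by (auto simp: dom_def)

lemma dom_zero [simp]: "dom 0 x"
  using closed(2) by (auto simp: dom_def)

lemma dom_one_right [simp]: "dom x 1 \<longleftrightarrow> x \<in> V"
  by (auto simp: dom_def)

lemma dom_trans: "dom x y \<Longrightarrow> dom y z \<Longrightarrow> dom x z"
  using closed(6) unfolding dom_def by (metis mult.assoc)

lemma dom_add: "dom x z \<Longrightarrow> dom y z \<Longrightarrow> dom (x + y) z"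
  using closed(5) unfolding dom_def by (metis distrib_right)

lemma dom_minus_left [simp]: "dom (- x) y \<longleftrightarrow> dom x y"
  using closed(3) unfolding dom_def by (metis minus_mult_left minus_minus)

lemma dom_minus_right [simp]: "dom x (- y) \<longleftrightarrow> dom x y"
  using closed(3) unfolding dom_def by (metis minus_mult_commute minus_minus)

lemma dom_diff: "dom x z \<Longrightarrow> dom y z \<Longrightarrow> dom (x - y) z"
  using dom_add[of x z "- y"] by simp

lemma dom_mult: "dom a b \<Longrightarrow> dom x y \<Longrightarrow> dom (a * x) (b * y)"
  using closed(6) unfolding dom_def by (metis mult.assoc mult.left_commute)

lemma dom_cancel: "c \<noteq> 0 \<Longrightarrow> dom (c * x) (c * y) \<Longrightarrow> dom x y"
  unfolding dom_def by (metis mult.left_commute mult_left_cancel)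

lemma dom_total: "dom x y \<or> dom y x"
proof (cases "x = 0 \<or> y = 0")
  case False
  then have "x = (x / y) * y" "y = inverse (x / y) * x" by auto
  then show ?thesis using valuation[of "x / y"] unfolding dom_def by blast
qed auto

text \<open>Equality of valuations, that is, equality up to a unit of \<open>V\<close>.\<close>

definition same :: "'a \<Rightarrow> 'a \<Rightarrow> bool" where
  "same x y \<longleftrightarrow> dom x y \<and> dom y x"

text \<open>The sharp ultrametric rule: of two terms with different valuations, the one of smaller
  valuation (here \<open>y\<close>) determines the sum.\<close>

lemma same_add:
  assumes "\<not> dom y x"
  shows "same (x + y) y" "same (y + x) y" "same (x - y) y" "same (y - x) y"
proof -
  have xy: "dom x y" using assms dom_total by blast
  have *: "same (y + z) y" if "dom z y" "\<not> dom y z" for z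
  proof -
    have "dom y (y + z)"
    proof (rule ccontr)
      assume "\<not> dom y (y + z)"
      then have "\<not> dom (- z) (y + z)"
        using dom_diff[of "y + z" "y + z" z] by auto
      then have "dom (y + z) z" using dom_total[of z "y + z"] by auto
      then have "dom y z" using dom_diff[of "y + z" z z] by simp
      with that show False by simp
    qed
    then show ?thesis using that by (simp add: same_def dom_add)
  qed
  show 1: "same (y + x) y" and 2: "same (y - x) y"
    using *[of x] *[of "- x"] xy assms by simp_all
  show "same (x + y) y" using 1 by (simp add: add.commute)
  have "x - y = - (y - x)" by simp
  then show "same (x - y) y" using 2 unfolding same_def by (metis dom_minus_left dom_minus_right)
qed

text \<open>Since v(c) < 0, the square of \<open>c\<close> outweighs 1 in 1 - c^2 = s^2, so the
  squares have equal valuation, and valuations can be halved.\<close>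

lemma same_sin:
  assumes "c\<^sup>2 + s\<^sup>2 = 1" "c \<notin> V"
  shows "same c s"
proof -
  have "\<not> dom (c\<^sup>2) 1"
  proof
    assume "dom (c\<^sup>2) 1"
    moreover have "dom 1 c" using dom_total[of 1 c] assms by auto
    then have "dom c (c\<^sup>2)" using dom_mult[of 1 c c c] by (simp add: power2_eq_square)
    ultimately show False using dom_trans[of c "c\<^sup>2" 1] assms by simp
  qed
  then have "same (1 - c\<^sup>2) (c\<^sup>2)" by (rule same_add)
  then have *: "same (s\<^sup>2) (c\<^sup>2)" using assms(1) by (metis add_diff_cancel_left')
  have sq: "dom x y" if xy: "dom (x\<^sup>2) (y\<^sup>2)" for x y
  proof (rule ccontr)
    assume n: "\<not> dom x y"
    then have yx: "dom y x" using dom_total by blast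
    have "x \<noteq> 0" using n by auto
    have "dom (x * y) (x * x)" using dom_mult[OF dom_refl yx] .
    have "dom (y * y) (x * y)" using dom_mult[OF yx dom_refl] .
    then have "dom (x * x) (x * y)" using xy dom_trans unfolding power2_eq_square by blast
    then show False using n dom_cancel \<open>x \<noteq> 0\<close> by blast
  qed
  then show ?thesis using * by (auto simp: same_def)
qed

text \<open>The two shapes of the orbit of the first basis vector: \<open>stateZ\<close> holds after a rotation
  about the z-axis and says \<open>v(x) = v(y) < v(z)\<close> and \<open>v(x) < 0\<close>; \<open>stateX\<close> holds before such a
  rotation and says that one of \<open>x\<close>, \<open>y\<close> strictly dominates the other and weakly dominates \<open>z\<close> and 1.\<close>

definition stateZ :: "'a \<Rightarrow> 'a \<Rightarrow> 'a \<Rightarrow> bool" where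
  "stateZ x y z \<longleftrightarrow> same x y \<and> \<not> dom x z \<and> x \<notin> V"

definition stateX :: "'a \<Rightarrow> 'a \<Rightarrow> 'a \<Rightarrow> bool" where
  "stateX x y z \<longleftrightarrow> (\<not> dom x y \<and> dom z x \<and> dom 1 x) \<or> (\<not> dom y x \<and> dom z y \<and> dom 1 y)"

text \<open>The pivot \<open>d\<close> has the least valuation among \<open>d\<close>,
  \<open>z\<close> and 1; multiplying it by \<open>c\<close> with v(c) < 0 goes strictly below all
  of them.\<close>

lemma grows:
  assumes c: "c \<notin> V" and d: "same u (c * d)" "dom z d"  "dom 1 d"
  shows "\<not> dom u z" "u \<notin> V"
proof -
  have d0: "d \<noteq> 0" using d(3) by (auto simp: dom_def)
  have *: "\<not> dom u z" if "dom z d" for z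
  proof
    assume "dom u z"
    then have "dom (c * d) d" using d that dom_trans unfolding same_def by blast
    then have "c \<in> V" using dom_cancel[of d c 1] d0 by (simp add: mult.commute)
    then show False using c by simp
  qed
  from *[OF d(2)] *[OF d(3)] show "\<not> dom u z" "u \<notin> V" by simp_all
qed

lemma same_trans: "same x y \<Longrightarrow> same y z \<Longrightarrow> same x z"
  and same_sym: "same x y \<Longrightarrow> same y x"
  using dom_trans unfolding same_def by blast+

lemma same_mult: "same a b \<Longrightarrow> same x y \<Longrightarrow> same (a * x) (b * y)"
  using dom_mult unfolding same_def by blast

lemma same_refl [simp]: "same x x"
  by (simp add: same_def)

lemma dom_refl_mult: "dom x y \<Longrightarrow> dom (c * x) (c * y)" "dom x y \<Longrightarrow> dom (x * c) (y * c)"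
  by (simp_all add: dom_mult)

text \<open>As \<open>c\<close> and \<open>s\<close> have equal valuation, the term with
  \<open>y\<close> outweighs the one with \<open>x\<close>. The four forms cover both new
  coordinates of a rotation, whichever of the two old ones is dominant.\<close>

lemma same_combination:
  assumes "same c s" "c \<noteq> 0" "\<not> dom y x"
  shows "same (c * x - s * y) (c * y)" "same (s * x + c * y) (c * y)"
    "same (c * y - s * x) (c * y)" "same (s * y + c * x) (c * y)"
proof -
  have 1: "\<not> dom (s * y) (c * x)"
  proof
    assume "dom (s * y) (c * x)"
    moreover have "dom (c * y) (s * y)" using assms(1) dom_refl_mult(2) by (simp add: same_def)
    ultimately show False using dom_trans dom_cancel[OF assms(2)] assms(3) by blast
  qed
  have 2: "\<not> dom (c * y) (s * x)"
  proof
    assume "dom (c * y) (s * x)"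
    moreover have "dom (s * x) (c * x)" using assms(1) dom_refl_mult(2) by (simp add: same_def)
    ultimately show False using dom_trans dom_cancel[OF assms(2)] assms(3) by blast
  qed
  have 3: "same (s * y) (c * y)" using assms same_mult same_sym by simp
  show "same (c * x - s * y) (c * y)" "same (s * y + c * x) (c * y)"
    using same_add[OF 1] 3 same_trans by blast+
  show "same (s * x + c * y) (c * y)" "same (c * y - s * x) (c * y)"
    using same_add[OF 2] by blast+
qed

text \<open>With \<open>d\<close> the one of \<open>x\<close> and \<open>y\<close> that has strictly
  smaller valuation, both new coordinates have the valuation of \<open>c * d\<close>, while
  \<open>z\<close> is unchanged.\<close>

lemma rotate_z:
  assumes cs: "c\<^sup>2 + s\<^sup>2 = 1" "c \<notin> V" and X: "stateX x y z"
  shows "stateZ (c * x - s * y) (s * x + c * y) z"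
proof -
  have sc: "same c s" using same_sin cs by blast
  have c0: "c \<noteq> 0" using cs closed by auto
  obtain d where d: "dom z d" "dom 1 d" "same (c * x - s * y) (c * d)" "same (s * x + c * y) (c * d)"
    using X same_combination[OF sc c0] unfolding stateX_def by blast
  then show ?thesis
    using grows[OF cs(2) d(3,1,2)] same_trans same_sym unfolding stateZ_def by blast
qed

text \<open>A quarter turn moves \<open>z\<close> into second place, strictly above \<open>x\<close>
  in valuation: the first alternative of \<open>stateX\<close>. Otherwise v(c) < 0, and both new
  coordinates have the valuation of \<open>c * y\<close>, strictly below that of \<open>x\<close>:
  the second alternative.\<close>

lemma rotate_x:
  assumes cs: "c\<^sup>2 + s\<^sup>2 = 1" "c \<notin> V \<or> c = 0" and Z: "stateZ x y z"
  shows "stateX x (c * y - s * z) (s * y + c * z)"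
proof (cases "c = 0")
  case True
  then have s: "s = 1 \<or> s = - 1" using cs by (simp add: power2_eq_1_iff)
  have "dom 1 x" using Z dom_total[of 1 x] by (auto simp: stateZ_def)
  then show ?thesis
    using Z True s unfolding stateX_def stateZ_def same_def by auto
next
  case False
  then have cV: "c \<notin> V" using cs by simp
  have sc: "same c s" using same_sin cs False by blast
  have yz: "\<not> dom y z" and xy: "same x y" using Z dom_trans unfolding stateZ_def same_def by blast+
  have "dom 1 x" using Z dom_total[of 1 x] by (auto simp: stateZ_def)
  then have y1: "dom 1 y" using xy dom_trans unfolding same_def by blast
  have u: "same (c * y - s * z) (c * y)" "same (s * y + c * z) (c * y)"
    using same_combination[OF sc False yz] by blast+
  have "\<not> dom (c * y - s * z) x" using grows[OF cV u(1) _ y1] xy unfolding same_def by blast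
  moreover have "dom (s * y + c * z) (c * y - s * z)" using u same_trans same_sym same_def by blast
  moreover have "c * y - s * z \<notin> V" using grows[OF cV u(1) _ y1] xy unfolding same_def by blast
  then have "dom 1 (c * y - s * z)" using dom_total[of 1 "c * y - s * z"] by auto
  ultimately show ?thesis unfolding stateX_def by blast
qed

end


section \<open>Roots of unity\<close>

text \<open>Writing n = 2k + 1, divisibility by 2 would give 1/2 = t - k in
  \<open>R\<close>.\<close>

lemma odd_in_subring_div_2:
  fixes R :: "'a::field set"
  assumes R: "subring_of_field R" and half: "inverse 2 \<notin> R" and "(2::'a) \<noteq> 0"
    and n: "odd n" "of_nat n = 2 * t"
  shows "t \<notin> R"
proof
  assume t: "t \<in> R"
  obtain k where "n = 2 * k + 1" using n oddE by blast
  then have "1 = 2 * (t - of_nat k)" using n(2) by (simp add: algebra_simps)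
  then have "inverse 2 = t - of_nat k" using assms(3) by (simp add: field_simps)
  moreover have "of_nat k \<in> R" by (induction k) (auto intro: subring_closed[OF R])
  ultimately show False using half t subring_closed(4)[OF R] by metis
qed

text \<open>Roots of unity congruent to 1 modulo 2 are trivial: for odd order \<open>n\<close> because \<open>1 - w\<close>
  divides \<open>n\<close>, and \<open>w = \<plusminus>\<i>\<close> is excluded because \<open>(1 - w)\<^sup>2 = - 2 w\<close> is not divisible by 4.\<close>

lemma root_of_unity_cong_1_mod_2:
  fixes R :: "'a::field set"
  assumes R: "subring_of_field R" and half: "inverse 2 \<notin> R" and two: "(2::'a) \<noteq> 0"
    and "w ^ n = 1" "0 < n" "w = 1 + 2 * t" "t \<in> R"
  shows "w = 1 \<or> w = - 1"
  using assms(4-7)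
proof (induction n arbitrary: w t rule: less_induct)
  case (less n)
  have wR: "w \<in> R"
    using less.prems subring_closed[OF R] by (metis one_add_one)
  \<comment> \<open>An even exponent is halved by passing to w^2, which is again congruent to 1
    modulo 2.\<close>
  show ?case
  proof (cases "even n")
    case True
    then obtain k where k: "n = 2 * k" by auto
    have "w\<^sup>2 ^ k = 1" using less.prems k by (simp add: power_mult)
    moreover have "w\<^sup>2 = 1 + 2 * (t * (1 + w))"
      using less.prems by (simp add: power2_eq_square algebra_simps)
    moreover have "t * (1 + w) \<in> R" using less.prems wR by (intro subring_closed[OF R])
    moreover have "k < n" "0 < k" using k less.prems by auto
    ultimately have "w\<^sup>2 = 1 \<or> w\<^sup>2 = - 1" using less.IH[of k "w\<^sup>2"] by blast
    then show ?thesis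
    proof
      assume w: "w\<^sup>2 = - 1"
      have "2 * (2 * t\<^sup>2) = (w - 1)\<^sup>2" using less.prems by (simp add: power2_eq_square)
      also have "\<dots> = 2 * (- w)" using w by (simp add: power2_diff)
      finally have "2 * t\<^sup>2 = - w" using two mult_left_cancel by blast
      then have "2 * t\<^sup>2 * w = - w * w" by simp
      then have "2 * (t\<^sup>2 * w) = 1" using w by (simp add: power2_eq_square mult.assoc)
      then have "inverse 2 = t\<^sup>2 * w" by (rule inverse_unique)
      moreover have "t\<^sup>2 * w \<in> R" using less.prems wR
        by (intro subring_closed[OF R] subring_power[OF R])
      ultimately show ?thesis using half by metis
    qed (simp add: power2_eq_1_iff)
  next
    case False
    show ?thesis
    proof (rule ccontr)
      assume "\<not> ?thesis"
      then have w1: "w \<noteq> 1" by simp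
      \<comment> \<open>Subtracting this vanishing sum from n leaves the terms 1 - w^i, each a
        multiple of 1 - w = - 2 t.\<close>
      have "(\<Sum>i<n. w ^ i) = 0"
        using less.prems w1 by (simp add: geometric_sum)
      then have "of_nat n = (\<Sum>i<n. 1 - w ^ i)" by (simp add: sum_subtractf)
      also have "\<dots> = (\<Sum>i<n. (1 - w) * (\<Sum>j<i. w ^ j))"
        by (simp add: one_diff_power_eq)
      also have "\<dots> = 2 * (\<Sum>i<n. - t * (\<Sum>j<i. w ^ j))"
        using less.prems by (simp add: sum_distrib_left mult.assoc)
      finally have "of_nat n = 2 * (\<Sum>i<n. - t * (\<Sum>j<i. w ^ j))" .
      then have "(\<Sum>i<n. - t * (\<Sum>j<i. w ^ j)) \<notin> R"
        using odd_in_subring_div_2[OF R half two] False by blast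
      moreover have "(\<Sum>i<n. - t * (\<Sum>j<i. w ^ j)) \<in> R"
        using less.prems wR
        by (intro subring_sum[OF R] subring_closed[OF R] subring_power[OF R])
      ultimately show False by simp
    qed
  qed
qed

text \<open>An integral cosine makes w = - e^(2it) = 1 - 2 cos t e^(it) congruent to 1 modulo 2, so
  w = 1 or w = - 1, which leaves only multiples of a quarter turn.\<close>

lemma real_valuation_ring:
  obtains V :: "real set" where "valuation_ring V"
    "\<And>n t. 0 < n \<Longrightarrow> cis t ^ n = 1 \<Longrightarrow> cos t \<in> V \<Longrightarrow> sin t = 0 \<or> cos t = 0"
proof -
  have Z: "subring_of_field (\<int> :: complex set)" by (simp add: subring_of_field_def)
  have "inverse 2 \<notin> (\<int> :: complex set)"
  proof
    assume "inverse 2 \<in> (\<int> :: complex set)"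
    then obtain k where "inverse 2 = (of_int k :: complex)" by (auto elim: Ints_cases)
    then have "(of_int (2 * k) :: complex) = of_int 1" by (simp add: field_simps)
    then have "2 * k = 1" by (simp only: of_int_eq_iff)
    then show False by presburger
  qed
  then obtain R :: "complex set" where R: "subring_of_field R" "inverse 2 \<notin> R"
    "\<And>x. x \<in> R \<or> inverse x \<in> R"
    using valuation_ring_exists[OF Z, of 2] Ints_numeral by metis
  note [intro] = subring_closed[OF R(1)]
  define V where "V = {x. complex_of_real x \<in> R}"
  have "subring_of_field V" by (auto simp: subring_of_field_def V_def)
  moreover have "x \<in> V \<or> inverse x \<in> V" for x
    using R(3)[of "complex_of_real x"] by (simp add: V_def)
  ultimately have "valuation_ring V" by unfold_locales
  moreover have "sin t = 0 \<or> cos t = 0" if n: "0 < n" "cis t ^ n = 1" and "cos t \<in> V" for n t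
  proof -
    have cR: "complex_of_real (cos t) \<in> R" using that by (simp add: V_def)
    have uR: "cis t \<in> R"
    proof (rule ccontr)
      assume "cis t \<notin> R"
      then have "inverse (cis t) \<in> R" using R(3) by blast
      \<comment> \<open>A root of unity is a power of its inverse, so it lies in \<open>R\<close>
        whichever of the two does.\<close>
      then have "inverse (cis t) ^ (n - 1) \<in> R" by (rule subring_power[OF R(1)])
      moreover have "inverse (cis t) ^ (n - 1) = cis t"
      proof -
        have "cis t * inverse (cis t) ^ n = cis t" using n by (simp only: power_inverse) simp
        moreover have "inverse (cis t) ^ n = inverse (cis t) * inverse (cis t) ^ (n - 1)"
          using n by (metis Suc_diff_1 power_Suc)
        ultimately show ?thesis by (simp add: cis_neq_zero mult.assoc[symmetric] del: cis_inverse)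
      qed
      ultimately show False using \<open>cis t \<notin> R\<close> by simp
    qed
    define w where "w = - (cis t)\<^sup>2"
    \<comment> \<open>The doubled exponent removes the sign in front of the square.\<close>
    have "w ^ (2 * n) = 1"
      using n by (simp add: w_def power_mult[symmetric] mult.commute) (simp add: power_mult)
    moreover have "w = 1 + 2 * (- (of_real (cos t) * cis t))"
    proof -
      have "(sin t)\<^sup>2 = 1 - (cos t)\<^sup>2" by (simp add: sin_squared_eq)
      then show ?thesis by (simp add: w_def complex_eq_iff power2_eq_square)
    qed
    moreover have "- (of_real (cos t) * cis t) \<in> R" using cR uR by auto
    ultimately have "w = 1 \<or> w = - 1"
      using root_of_unity_cong_1_mod_2[OF R(1,2), of w "2 * n"] n by fastforce
    then have "Im w = 0" by auto
    then show ?thesis by (auto simp: w_def power2_eq_square)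
  qed
  ultimately show ?thesis using that by blast
qed


section \<open>Homomorphisms from cyclic and dihedral groups\<close>

lemma presented_hom_unique:
  assumes K: "group K" and h: "h \<in> hom (presented X R) K" "h' \<in> hom (presented X R) K"
    and eq: "\<And>x. x \<in> X \<Longrightarrow> h (pgen X R x) = h' (pgen X R x)"
    and U: "U \<in> carrier (presented X R)"
  shows "h U = h' U"
proof -
  interpret h: group_hom "presented X R" K h
    using K h group_presented by (simp add: group_hom_def group_hom_axioms_def)
  interpret h': group_hom "presented X R" K h'
    using K h group_presented by (simp add: group_hom_def group_hom_axioms_def)
  show ?thesis
    using U
    by (induction rule: presented_induct) (auto simp: pgen_in_carrier eq)
qed

text \<open>Rewrites inverses as natural powers, so that the cyclic and dihedral normal forms use
  exponents in \<open>nat\<close> only.\<close>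

lemma (in group) inv_nat_pow_torsion:
  assumes "r \<in> carrier G" "r [^] n = \<one>" "0 < (n::nat)"
  shows "inv (r [^] (a::nat)) = r [^] ((n - 1) * a)"
proof (rule inv_equality)
  have "r [^] ((n - 1) * a) \<otimes> r [^] a = r [^] (n * a)"
    using assms by (simp add: nat_pow_mult) (simp add: algebra_simps)
  also have "\<dots> = \<one>" using assms by (simp add: nat_pow_pow[symmetric])
  finally show "r [^] ((n - 1) * a) \<otimes> r [^] a = \<one>" .
qed (use assms in auto)

lemma cyc_gen_closed [simp]: "cyc_gen n \<in> carrier (cyc n)"
  and dih_rot_closed [simp]: "dih_rot n \<in> carrier (dih n)"
  and dih_refl_closed [simp]: "dih_refl n \<in> carrier (dih n)"
  by (auto simp: cyc_gen_def cyc_def dih_rot_def dih_refl_def dih_def intro!: pgen_in_carrier)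

lemma cyc_gen_pow: "cyc_gen n [^]\<^bsub>cyc n\<^esub> n = \<one>\<^bsub>cyc n\<^esub>"
proof -
  interpret group "cyc n" by (rule group_cyc)
  have "word_eval (cyc n) (pgen UNIV (cyc_rels n)) (replicate n ((), True)) = \<one>\<^bsub>cyc n\<^esub>"
    unfolding cyc_def by (rule word_eval_relator) (auto simp: cyc_rels_def)
  moreover have "pgen UNIV (cyc_rels n) () \<in> carrier (cyc n)"
    using cyc_gen_closed by (simp add: cyc_gen_def)
  ultimately show ?thesis by (simp add: word_eval_replicate cyc_gen_def)
qed

lemma dih_relations:
  shows "dih_rot n [^]\<^bsub>dih n\<^esub> n = \<one>\<^bsub>dih n\<^esub>"
    and "dih_refl n \<otimes>\<^bsub>dih n\<^esub> dih_refl n = \<one>\<^bsub>dih n\<^esub>"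
    and "dih_refl n \<otimes>\<^bsub>dih n\<^esub> (dih_rot n \<otimes>\<^bsub>dih n\<^esub> (dih_refl n \<otimes>\<^bsub>dih n\<^esub> dih_rot n)) = \<one>\<^bsub>dih n\<^esub>"
proof -
  interpret group "dih n" by (rule group_dih)
  have *: "word_eval (dih n) (pgen UNIV (dih_rels n)) r = \<one>\<^bsub>dih n\<^esub>" if "r \<in> dih_rels n" for r
    unfolding dih_def by (rule word_eval_relator) (use that in \<open>auto simp: dih_rels_def\<close>)
  have cl: "pgen UNIV (dih_rels n) Rot \<in> carrier (dih n)" "pgen UNIV (dih_rels n) Refl \<in> carrier (dih n)"
    using dih_rot_closed dih_refl_closed by (simp_all add: dih_rot_def dih_refl_def)
  show "dih_rot n [^]\<^bsub>dih n\<^esub> n = \<one>\<^bsub>dih n\<^esub>"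
    using *[of "replicate n (Rot, True)"] cl
    by (simp add: dih_rels_def word_eval_replicate dih_rot_def)
  show "dih_refl n \<otimes>\<^bsub>dih n\<^esub> dih_refl n = \<one>\<^bsub>dih n\<^esub>"
    using *[of "[(Refl, True), (Refl, True)]"] cl by (simp add: dih_rels_def dih_refl_def)
  show "dih_refl n \<otimes>\<^bsub>dih n\<^esub> (dih_rot n \<otimes>\<^bsub>dih n\<^esub> (dih_refl n \<otimes>\<^bsub>dih n\<^esub> dih_rot n)) = \<one>\<^bsub>dih n\<^esub>"
    using *[of "[(Refl, True), (Rot, True), (Refl, True), (Rot, True)]"] cl
    by (simp add: dih_rels_def dih_refl_def dih_rot_def)
qed

lemma cyc_cases:
  assumes "0 < n" "x \<in> carrier (cyc n)"
  obtains a :: nat where "x = cyc_gen n [^]\<^bsub>cyc n\<^esub> a"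
proof -
  interpret group "cyc n" by (rule group_cyc)
  have "x \<in> carrier (presented UNIV (cyc_rels n))" using assms by (simp add: cyc_def)
  then have "\<exists>a::nat. x = cyc_gen n [^]\<^bsub>cyc n\<^esub> a"
  proof (induction rule: presented_induct)
    case one
    have "\<one>\<^bsub>cyc n\<^esub> = cyc_gen n [^]\<^bsub>cyc n\<^esub> (0::nat)" by simp
    then show ?case unfolding cyc_def by blast
  next
    case (gen u V)
    then obtain a :: nat where "V = cyc_gen n [^]\<^bsub>cyc n\<^esub> a" by blast
    then have "cyc_gen n \<otimes>\<^bsub>cyc n\<^esub> V = cyc_gen n [^]\<^bsub>cyc n\<^esub> (1 + a)"
      using nat_pow_mult[of "cyc_gen n" 1 a] by simp
    then show ?case unfolding cyc_gen_def cyc_def unit_eq[of u] by blast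
  next
    case (inv u V)
    then obtain a :: nat where "V = cyc_gen n [^]\<^bsub>cyc n\<^esub> a" by blast
    then have "inv\<^bsub>cyc n\<^esub> cyc_gen n \<otimes>\<^bsub>cyc n\<^esub> V = cyc_gen n [^]\<^bsub>cyc n\<^esub> (n - 1 + a)"
      using inv_nat_pow_torsion[OF _ cyc_gen_pow assms(1), of 1] nat_pow_mult[of "cyc_gen n"]
      by simp
    then show ?case unfolding cyc_gen_def cyc_def unit_eq[of u] by blast
  qed
  then show ?thesis using that by blast
qed

text \<open>The elements r^a and r^a s are closed under left multiplication by the generators,
  because s r^a = r^(-a) s.\<close>

lemma dih_cases:
  assumes "0 < n" "x \<in> carrier (dih n)"
  obtains a :: nat where "x = dih_rot n [^]\<^bsub>dih n\<^esub> a"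
  | a :: nat where "x = dih_rot n [^]\<^bsub>dih n\<^esub> a \<otimes>\<^bsub>dih n\<^esub> dih_refl n"
proof -
  interpret group "dih n" by (rule group_dih)
  let ?r = "dih_rot n" and ?s = "dih_refl n"
  let ?Q = "\<lambda>x. \<exists>a::nat. x = ?r [^]\<^bsub>dih n\<^esub> a \<or> x = ?r [^]\<^bsub>dih n\<^esub> a \<otimes>\<^bsub>dih n\<^esub> ?s"
  note inv_pow = inv_nat_pow_torsion[OF dih_rot_closed dih_relations(1) assms(1)]
  have rot: "?Q (?r [^]\<^bsub>dih n\<^esub> (b::nat) \<otimes>\<^bsub>dih n\<^esub> V)" if V: "?Q V" for b V
  proof -
    obtain a :: nat where "V = ?r [^]\<^bsub>dih n\<^esub> a \<or> V = ?r [^]\<^bsub>dih n\<^esub> a \<otimes>\<^bsub>dih n\<^esub> ?s"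
      using V by blast
    then show ?thesis
      by (intro exI[of _ "b + a"]) (auto simp: nat_pow_mult m_assoc[symmetric])
  qed
  have sr: "?s \<otimes>\<^bsub>dih n\<^esub> ?r = inv\<^bsub>dih n\<^esub> ?r \<otimes>\<^bsub>dih n\<^esub> ?s"
  proof -
    \<comment> \<open>The third relator says that s r is its own inverse.\<close>
    have "(?s \<otimes>\<^bsub>dih n\<^esub> ?r) \<otimes>\<^bsub>dih n\<^esub> (?s \<otimes>\<^bsub>dih n\<^esub> ?r) = \<one>\<^bsub>dih n\<^esub>"
      using dih_relations(3) by (simp add: m_assoc)
    then have "?s \<otimes>\<^bsub>dih n\<^esub> ?r = inv\<^bsub>dih n\<^esub> (?s \<otimes>\<^bsub>dih n\<^esub> ?r)"
      using inv_equality by (metis dih_rot_closed dih_refl_closed m_closed)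
    also have "\<dots> = inv\<^bsub>dih n\<^esub> ?r \<otimes>\<^bsub>dih n\<^esub> inv\<^bsub>dih n\<^esub> ?s" by (simp add: inv_mult_group)
    also have "inv\<^bsub>dih n\<^esub> ?s = ?s" using inv_equality dih_relations(2) by auto
    finally show ?thesis .
  qed
  have sra: "?s \<otimes>\<^bsub>dih n\<^esub> ?r [^]\<^bsub>dih n\<^esub> (a::nat) = inv\<^bsub>dih n\<^esub> (?r [^]\<^bsub>dih n\<^esub> a) \<otimes>\<^bsub>dih n\<^esub> ?s" for a
  proof (induction a)
    case (Suc a)
    have "?s \<otimes>\<^bsub>dih n\<^esub> ?r [^]\<^bsub>dih n\<^esub> Suc a = inv\<^bsub>dih n\<^esub> (?r [^]\<^bsub>dih n\<^esub> a) \<otimes>\<^bsub>dih n\<^esub> (?s \<otimes>\<^bsub>dih n\<^esub> ?r)"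
      by (simp add: Suc m_assoc[symmetric])
    also have "\<dots> = inv\<^bsub>dih n\<^esub> (?r [^]\<^bsub>dih n\<^esub> a) \<otimes>\<^bsub>dih n\<^esub> inv\<^bsub>dih n\<^esub> ?r \<otimes>\<^bsub>dih n\<^esub> ?s"
      by (simp add: sr m_assoc)
    also have "inv\<^bsub>dih n\<^esub> (?r [^]\<^bsub>dih n\<^esub> a) \<otimes>\<^bsub>dih n\<^esub> inv\<^bsub>dih n\<^esub> ?r = inv\<^bsub>dih n\<^esub> (?r [^]\<^bsub>dih n\<^esub> Suc a)"
      using nat_pow_mult[of ?r 1 a] by (simp add: inv_mult_group[symmetric])
    finally show ?case .
  qed simp
  have refl: "?Q (?s \<otimes>\<^bsub>dih n\<^esub> V)" if V: "?Q V" for V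
  proof -
    obtain a :: nat where "V = ?r [^]\<^bsub>dih n\<^esub> a \<or> V = ?r [^]\<^bsub>dih n\<^esub> a \<otimes>\<^bsub>dih n\<^esub> ?s"
      using V by blast
    then show ?thesis
    proof
      assume "V = ?r [^]\<^bsub>dih n\<^esub> a"
      then show ?thesis using sra[of a] inv_pow[of a] by auto
    next
      assume Vs: "V = ?r [^]\<^bsub>dih n\<^esub> a \<otimes>\<^bsub>dih n\<^esub> ?s"
      then have "?s \<otimes>\<^bsub>dih n\<^esub> V = inv\<^bsub>dih n\<^esub> (?r [^]\<^bsub>dih n\<^esub> a) \<otimes>\<^bsub>dih n\<^esub> (?s \<otimes>\<^bsub>dih n\<^esub> ?s)"
        using sra[of a] by (metis dih_refl_closed dih_rot_closed inv_closed m_assoc nat_pow_closed)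
      then have "?s \<otimes>\<^bsub>dih n\<^esub> V = ?r [^]\<^bsub>dih n\<^esub> ((n - 1) * a)"
        using inv_pow[of a] dih_relations(2)[of n] by simp
      then show ?thesis by blast
    qed
  qed
  have "x \<in> carrier (presented UNIV (dih_rels n))" using assms by (simp add: dih_def)
  then have "?Q x"
  proof (induction rule: presented_induct)
    case one
    have "\<one>\<^bsub>dih n\<^esub> = ?r [^]\<^bsub>dih n\<^esub> (0::nat)" by simp
    then show ?case unfolding dih_def[symmetric] by blast
  next
    case (gen u V)
    have "pgen UNIV (dih_rels n) u = (case u of Rot \<Rightarrow> ?r [^]\<^bsub>dih n\<^esub> (1::nat) | Refl \<Rightarrow> ?s)"
      by (auto simp: dih_rot_def[symmetric] dih_refl_def[symmetric] split: dih_letter.split)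
    then show ?case
      unfolding dih_def[symmetric] using rot[OF gen(3), of 1] refl[OF gen(3)] by (cases u) auto
  next
    case (inv u V)
    have "inv\<^bsub>dih n\<^esub> (pgen UNIV (dih_rels n) u) =
        (case u of Rot \<Rightarrow> ?r [^]\<^bsub>dih n\<^esub> (n - 1) | Refl \<Rightarrow> ?s)"
      using inv_pow[of 1] inv_equality[OF dih_relations(2)]
      by (auto simp: dih_rot_def[symmetric] dih_refl_def[symmetric] split: dih_letter.split)
    then show ?case
      unfolding dih_def[symmetric] using rot[OF inv(3), of "n - 1"] refl[OF inv(3)] by (cases u) auto
  qed
  then show ?thesis using that by blast
qed

definition cyc_hom :: "('b, 'm) monoid_scheme \<Rightarrow> 'b \<Rightarrow> unit word set \<Rightarrow> 'b" where
  "cyc_hom K r = presented_hom K (\<lambda>_. r)"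

definition dih_hom :: "('b, 'm) monoid_scheme \<Rightarrow> 'b \<Rightarrow> 'b \<Rightarrow> dih_letter word set \<Rightarrow> 'b" where
  "dih_hom K r s = presented_hom K (case_dih_letter r s)"

context group
begin

lemma cyc_hom:
  assumes r: "r \<in> carrier G" "r [^] n = \<one>"
  shows "cyc_hom G r \<in> hom (cyc n) G" "cyc_hom G r (cyc_gen n) = r"
    and "subgroup S G \<Longrightarrow> r \<in> S \<Longrightarrow> cyc_hom G r ` carrier (cyc n) \<subseteq> S"
proof -
  have \<phi>: "(\<lambda>_. r) ` UNIV \<subseteq> carrier G" using r by auto
  have R: "word_eval G (\<lambda>_. r) w = \<one>" if "w \<in> cyc_rels n" for w
    using that r by (auto simp: cyc_rels_def word_eval_replicate)
  show "cyc_hom G r \<in> hom (cyc n) G" "cyc_hom G r (cyc_gen n) = r"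
    unfolding cyc_hom_def cyc_def cyc_gen_def using presented_hom[OF \<phi> R] by auto
  assume S: "subgroup S G" "r \<in> S"
  have "presented_hom G (\<lambda>_. r) U \<in> S" if "U \<in> carrier (presented UNIV (cyc_rels n))" for U
    using presented_hom_image[OF is_group S(1) _ R that] S by auto
  then show "cyc_hom G r ` carrier (cyc n) \<subseteq> S"
    unfolding cyc_hom_def cyc_def by auto
qed

lemma dih_hom:
  assumes r: "r \<in> carrier G" "r [^] n = \<one>" and s: "s \<in> carrier G" "s \<otimes> s = \<one>"
    and rs: "s \<otimes> (r \<otimes> (s \<otimes> r)) = \<one>"
  shows "dih_hom G r s \<in> hom (dih n) G"
    and "dih_hom G r s (dih_rot n) = r" "dih_hom G r s (dih_refl n) = s"
    and "subgroup S G \<Longrightarrow> r \<in> S \<Longrightarrow> s \<in> S \<Longrightarrow> dih_hom G r s ` carrier (dih n) \<subseteq> S"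
proof -
  have \<phi>: "case_dih_letter r s ` UNIV \<subseteq> carrier G" using r s by (auto split: dih_letter.split)
  have R: "word_eval G (case_dih_letter r s) w = \<one>" if "w \<in> dih_rels n" for w
    using that r s rs by (auto simp: dih_rels_def word_eval_replicate)
  show "dih_hom G r s \<in> hom (dih n) G"
    "dih_hom G r s (dih_rot n) = r" "dih_hom G r s (dih_refl n) = s"
    unfolding dih_hom_def dih_def dih_rot_def dih_refl_def using presented_hom[OF \<phi> R] by auto
  assume S: "subgroup S G" "r \<in> S" "s \<in> S"
  have "presented_hom G (case_dih_letter r s) U \<in> S" if "U \<in> carrier (presented UNIV (dih_rels n))" for U
  proof (rule presented_hom_image[OF is_group S(1) _ R that])
    show "case_dih_letter r s ` UNIV \<subseteq> S" using S by (auto split: dih_letter.split)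
  qed
  then show "dih_hom G r s ` carrier (dih n) \<subseteq> S"
    unfolding dih_hom_def dih_def by auto
qed

end

lemma cyc_hom_eqI:
  assumes "group K" "h \<in> hom (cyc n) K" "h' \<in> hom (cyc n) K" "h (cyc_gen n) = h' (cyc_gen n)"
    and "x \<in> carrier (cyc n)"
  shows "h x = h' x"
proof (rule presented_hom_unique[where h = h and h' = h' and X = UNIV and R = "cyc_rels n"])
  fix u show "h (pgen UNIV (cyc_rels n) u) = h' (pgen UNIV (cyc_rels n) u)"
    using assms(4) by (simp add: cyc_gen_def)
qed (use assms in \<open>auto simp: cyc_def\<close>)

lemma dih_hom_eqI:
  assumes "group K" "h \<in> hom (dih n) K" "h' \<in> hom (dih n) K"
    and "h (dih_rot n) = h' (dih_rot n)" "h (dih_refl n) = h' (dih_refl n)"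
    and "x \<in> carrier (dih n)"
  shows "h x = h' x"
proof (rule presented_hom_unique[where h = h and h' = h' and X = UNIV and R = "dih_rels n"])
  fix u show "h (pgen UNIV (dih_rels n) u) = h' (pgen UNIV (dih_rels n) u)"
    using assms(4,5) by (cases u) (auto simp: dih_rot_def dih_refl_def)
qed (use assms in \<open>auto simp: dih_def\<close>)


section \<open>Rotations\<close>

lemma SO3_simps [simp]: "monoid.mult SO3 = (**)" "one SO3 = mat 1"
  by (simp_all add: SO3_def)

lemma Rx_add: "Rx t ** Rx u = Rx (t + u)"
  by (simp add: Rx_def vec_eq_iff forall_3 matrix_matrix_mult_def sum_3 cos_add sin_add)

lemma Rz_add: "Rz t ** Rz u = Rz (t + u)"
  by (simp add: Rz_def vec_eq_iff forall_3 matrix_matrix_mult_def sum_3 cos_add sin_add)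

lemma Rx_0 [simp]: "Rx 0 = mat 1"
  by (simp add: Rx_def vec_eq_iff forall_3 mat_def)

lemma Rz_0 [simp]: "Rz 0 = mat 1"
  by (simp add: Rz_def vec_eq_iff forall_3 mat_def)

lemma Rx_cong: "cos t = cos u \<Longrightarrow> sin t = sin u \<Longrightarrow> Rx t = Rx u"
  and Rz_cong: "cos t = cos u \<Longrightarrow> sin t = sin u \<Longrightarrow> Rz t = Rz u"
  by (simp_all add: Rx_def Rz_def)

lemma Rx_pow: "Rx t [^]\<^bsub>SO3\<^esub> (n::nat) = Rx (real n * t)"
  by (induction n) (simp_all add: Rx_add algebra_simps)

lemma Rz_pow: "Rz t [^]\<^bsub>SO3\<^esub> (n::nat) = Rz (real n * t)"
  by (induction n) (simp_all add: Rz_add algebra_simps)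

lemma Rx_2pi [simp]: "Rx (2 * pi) = mat 1" and Rz_2pi [simp]: "Rz (2 * pi) = mat 1"
  using Rx_cong[of "2 * pi" 0] Rz_cong[of "2 * pi" 0] by simp_all

text \<open>A half turn inverts every rotation about a perpendicular axis; this is the dihedral
  relator.\<close>

lemma Rx_pi_conj: "Rx pi ** (Rz t ** (Rx pi ** Rz t)) = mat 1"
  using sin_cos_squared_add[of t]
  by (simp add: Rx_def Rz_def vec_eq_iff forall_3 matrix_matrix_mult_def sum_3 mat_def
      power2_eq_square algebra_simps)

lemma Rz_pi_conj: "Rz pi ** (Rx t ** (Rz pi ** Rx t)) = mat 1"
  using sin_cos_squared_add[of t]
  by (simp add: Rx_def Rz_def vec_eq_iff forall_3 matrix_matrix_mult_def sum_3 mat_def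
      power2_eq_square algebra_simps)

lemma Rx_eq_1: "Rx t = mat 1 \<Longrightarrow> cos t = 1"
  and Rz_eq_1: "Rz t = mat 1 \<Longrightarrow> cos t = 1"
  and Rx_Rz_pi: "Rx t ** Rz pi \<noteq> mat 1" and Rz_Rx_pi: "Rz t ** Rx pi \<noteq> mat 1"
  by (simp_all add: Rx_def Rz_def vec_eq_iff forall_3 matrix_matrix_mult_def sum_3 mat_def)

lemma sin_0_imp: "sin t = 0 \<Longrightarrow> cos t = 1 \<or> cos t = - 1" for t :: real
  using sin_cos_squared_add[of t] by (simp add: power2_eq_1_iff)

lemma Rx_sin_0: "sin t = 0 \<Longrightarrow> Rx t = mat 1 \<or> Rx t = Rx pi"
  using sin_0_imp[of t] Rx_cong[of t 0] Rx_cong[of t pi] by auto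

lemma Rz_sin_0: "sin t = 0 \<Longrightarrow> Rz t = mat 1 \<or> Rz t = Rz pi"
  using sin_0_imp[of t] Rz_cong[of t 0] Rz_cong[of t pi] by auto

lemma cos_rational_eq_1:
  assumes "0 < n" "cos (real a * (2 * pi / real n)) = 1"
  shows "n dvd a"
proof -
  obtain k :: int where "real a * (2 * pi / real n) = k * 2 * pi"
    using assms(2) by (auto simp: cos_one_2pi_int)
  then have "real a = real_of_int (k * int n)" using assms(1) by (simp add: field_simps)
  then have "int a = k * int n" by linarith
  then show ?thesis by (metis dvd_triv_right int_dvd_int_iff)
qed

lemma group_hom_injI:
  assumes "group G" "group H" "h \<in> hom G H" "\<And>x. x \<in> carrier G \<Longrightarrow> h x = \<one>\<^bsub>H\<^esub> \<Longrightarrow> x = \<one>\<^bsub>G\<^esub>"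
  shows "inj_on h (carrier G)"
  using assms inj_on_one_iff'[of h G H] by blast

text \<open>Every element is a power of the generator, and the rotation by 2 pi / n has order
  exactly n; hence the presented group acts faithfully.\<close>

lemma cyc_rep:
  assumes n: "0 < n"
  defines "h \<equiv> cyc_hom SO3 (Rx (2 * pi / real n))"
  shows "h \<in> hom (cyc n) SO3" "h (cyc_gen n) = Rx (2 * pi / real n)"
    and "h (cyc_gen n [^]\<^bsub>cyc n\<^esub> (a::nat)) = Rx (real a * (2 * pi / real n))"
    and "inj_on h (carrier (cyc n))"
proof -
  interpret K: group SO3 by (rule group_SO3)
  interpret C: group "cyc n" by (rule group_cyc)
  have r: "Rx (2 * pi / real n) [^]\<^bsub>SO3\<^esub> n = \<one>\<^bsub>SO3\<^esub>"
    using n by (simp add: Rx_pow)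
  show h: "h \<in> hom (cyc n) SO3" and g: "h (cyc_gen n) = Rx (2 * pi / real n)"
    unfolding h_def using K.cyc_hom[OF Rx_in_SO3 r] by auto
  have pow: "h (cyc_gen n [^]\<^bsub>cyc n\<^esub> (a::nat)) = Rx (real a * (2 * pi / real n))" for a
    using hom_nat_pow[OF h cyc_gen_closed, of a] group_cyc group_SO3 by (simp add: g Rx_pow)
  show "h (cyc_gen n [^]\<^bsub>cyc n\<^esub> (a::nat)) = Rx (real a * (2 * pi / real n))" by (rule pow)
  show "inj_on h (carrier (cyc n))"
  proof (rule group_hom_injI[OF group_cyc group_SO3 h])
    fix x assume "x \<in> carrier (cyc n)" and x: "h x = \<one>\<^bsub>SO3\<^esub>"
    then obtain a :: nat where a: "x = cyc_gen n [^]\<^bsub>cyc n\<^esub> a" using cyc_cases[OF n] by blast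
    then have "n dvd a" using x pow Rx_eq_1 cos_rational_eq_1[OF n] by simp
    then obtain b where "a = n * b" by (auto elim: dvdE)
    then show "x = \<one>\<^bsub>cyc n\<^esub>" by (simp add: a C.nat_pow_pow[symmetric] cyc_gen_pow)
  qed
qed

text \<open>The pair \<open>Ra\<close> chooses the axis of the rotations and the axis of the half
  turn, so one statement serves both D_p and D_q.\<close>

lemma dih_rep:
  assumes n: "0 < n" and "Ra \<in> {(Rx, Rz), (Rz, Rx)}"
  defines "h \<equiv> dih_hom SO3 (fst Ra (2 * pi / real n)) (snd Ra pi)"
  shows "h \<in> hom (dih n) SO3" "h (dih_refl n) = snd Ra pi"
    and "h (dih_rot n [^]\<^bsub>dih n\<^esub> (a::nat)) = fst Ra (real a * (2 * pi / real n))"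
    and "inj_on h (carrier (dih n))"
    and "subgroup S SO3 \<Longrightarrow> fst Ra (2 * pi / real n) \<in> S \<Longrightarrow> snd Ra pi \<in> S \<Longrightarrow>
      h ` carrier (dih n) \<subseteq> S"
    and "h (dih_rot n) = fst Ra (2 * pi / real n)"
proof -
  interpret K: group SO3 by (rule group_SO3)
  interpret D: group "dih n" by (rule group_dih)
  let ?r = "fst Ra (2 * pi / real n)" and ?s = "snd Ra pi"
  have cl: "?r \<in> carrier SO3" "?s \<in> carrier SO3"
    using assms(2) Rx_in_SO3 Rz_in_SO3 by auto
  have pow: "?r [^]\<^bsub>SO3\<^esub> (a::nat) = fst Ra (real a * (2 * pi / real n))" for a
    using assms(2) Rx_pow Rz_pow by auto
  have r: "?r [^]\<^bsub>SO3\<^esub> n = \<one>\<^bsub>SO3\<^esub>"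
    unfolding pow using n assms(2) by auto
  have s: "?s \<otimes>\<^bsub>SO3\<^esub> ?s = \<one>\<^bsub>SO3\<^esub>"
    using assms(2) Rx_add[of pi pi] Rz_add[of pi pi] by auto
  have rs: "?s \<otimes>\<^bsub>SO3\<^esub> (?r \<otimes>\<^bsub>SO3\<^esub> (?s \<otimes>\<^bsub>SO3\<^esub> ?r)) = \<one>\<^bsub>SO3\<^esub>"
    using assms(2) Rx_pi_conj Rz_pi_conj by auto
  note hom = K.dih_hom[OF cl(1) r cl(2) s rs, folded h_def]
  show h: "h \<in> hom (dih n) SO3" and "h (dih_refl n) = ?s" "h (dih_rot n) = ?r" using hom by auto
  have hpow: "h (dih_rot n [^]\<^bsub>dih n\<^esub> (a::nat)) = fst Ra (real a * (2 * pi / real n))" for a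
    using hom_nat_pow[OF h dih_rot_closed, of a] group_dih group_SO3 by (simp add: hom pow)
  show "h (dih_rot n [^]\<^bsub>dih n\<^esub> (a::nat)) = fst Ra (real a * (2 * pi / real n))" by (rule hpow)
  show "inj_on h (carrier (dih n))"
  proof (rule group_hom_injI[OF group_dih group_SO3 h])
    fix x assume x: "x \<in> carrier (dih n)" "h x = \<one>\<^bsub>SO3\<^esub>"
    from dih_cases[OF n x(1)] show "x = \<one>\<^bsub>dih n\<^esub>"
    proof cases
      case (1 a)
      then have "n dvd a"
        using x hpow[of a] assms(2) Rx_eq_1 Rz_eq_1 cos_rational_eq_1[OF n] by auto
      then obtain b where "a = n * b" by (auto elim: dvdE)
      then show ?thesis by (simp add: 1 D.nat_pow_pow[symmetric] dih_relations)
    next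
      case (2 a)
      then have "h x = fst Ra (real a * (2 * pi / real n)) ** ?s"
        using hom_mult[OF h] hpow[of a] hom by simp
      \<comment> \<open>A rotation times the perpendicular half turn has - 1 on the diagonal, hence
        is never the identity.\<close>
      then have False using x(2) assms(2) Rx_Rz_pi Rz_Rx_pi by force
      then show ?thesis ..
    qed
  qed
  show "subgroup S SO3 \<Longrightarrow> ?r \<in> S \<Longrightarrow> ?s \<in> S \<Longrightarrow> h ` carrier (dih n) \<subseteq> S"
    by (rule hom(4))
qed


section \<open>Alternating products of rotations\<close>

lemma cis_rational:
  assumes "0 < n"
  shows "cis (real a * (2 * pi / real n)) ^ n = 1"
proof -
  have "real n * (real a * (2 * pi / real n)) = 2 * pi * real a" using assms by simp
  then show ?thesis unfolding Complex.DeMoivre by (simp only: cis_multiple_2pi Ints_of_nat)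
qed

lemma Rx_mult_vec [simp]:
  "(Rx t *v v) $ 1 = v $ 1"
  "(Rx t *v v) $ 2 = cos t * v $ 2 - sin t * v $ 3"
  "(Rx t *v v) $ 3 = sin t * v $ 2 + cos t * v $ 3"
  by (simp_all add: Rx_def matrix_vector_mult_def sum_3)

lemma Rz_mult_vec [simp]:
  "(Rz t *v v) $ 1 = cos t * v $ 1 - sin t * v $ 2"
  "(Rz t *v v) $ 2 = sin t * v $ 1 + cos t * v $ 2"
  "(Rz t *v v) $ 3 = v $ 3"
  by (simp_all add: Rz_def matrix_vector_mult_def sum_3)

locale dyadic = valuation_ring V for V :: "real set" +
  assumes cos_integral: "0 < n \<Longrightarrow> cis t ^ n = 1 \<Longrightarrow> cos t \<in> V \<Longrightarrow> sin t = 0 \<or> cos t = 0"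
begin

definition afterZ :: "real ^ 3 \<Rightarrow> bool" where
  "afterZ v \<longleftrightarrow> stateZ (v $ 1) (v $ 2) (v $ 3)"

definition beforeZ :: "real ^ 3 \<Rightarrow> bool" where
  "beforeZ v \<longleftrightarrow> stateX (v $ 1) (v $ 2) (v $ 3)"

text \<open>A letter is a rotation or a rotation times the perpendicular half turn; \<open>D\<close>
  covers both kinds.\<close>

lemma afterZ_letter:
  assumes "0 < n" "cis t ^ n = 1" "sin t \<noteq> 0" "cos t \<noteq> 0" and D: "D \<in> {mat 1, Rx pi}"
    and v: "beforeZ v"
  shows "afterZ ((Rz t ** D) *v v)"
proof -
  have "beforeZ (D *v v)" using D v by (auto simp: beforeZ_def stateX_def)
  moreover have "cos t \<notin> V" using cos_integral assms by blast
  ultimately show ?thesis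
    using rotate_z[of "cos t" "sin t"]
    by (simp add: afterZ_def beforeZ_def matrix_vector_mul_assoc[symmetric])
qed

lemma beforeZ_letter:
  assumes "0 < n" "cis t ^ n = 1" "sin t \<noteq> 0" and D: "D \<in> {mat 1, Rz pi}"
    and v: "afterZ v"
  shows "beforeZ ((Rx t ** D) *v v)"
proof -
  have "afterZ (D *v v)"
    using D v by (auto simp: afterZ_def stateZ_def same_def dest: closed(3))
  moreover have "cos t \<notin> V \<or> cos t = 0" using cos_integral assms by blast
  ultimately show ?thesis
    using rotate_x[of "cos t" "sin t"]
    by (simp add: afterZ_def beforeZ_def matrix_vector_mul_assoc[symmetric])
qed

text \<open>Start of the orbit: the vector is fixed up to sign, and x = 1 or x = - 1 with y = z = 0
  satisfies the first alternative of \<open>stateX\<close>.\<close>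

lemma beforeZ_axis: "D \<in> {mat 1, Rz pi} \<Longrightarrow> beforeZ ((Rx t ** D) *v axis 1 1)"
  using closed(1,2) closed(3)[OF closed(1)]
  by (auto simp: beforeZ_def stateX_def matrix_vector_mul_assoc[symmetric] axis_def dom_def)

text \<open>Handles products whose leftmost letter is from \<open>G\<close>: the letter changes the
  first coordinate at most in sign.\<close>

lemma first_coordinate_letter:
  assumes "D \<in> {mat 1, Rz pi}" "afterZ v"
  shows "((Rx t ** D) *v v) $ 1 \<notin> V"
  using assms closed(3)[of "- v $ 1"]
  by (auto simp: afterZ_def stateZ_def matrix_vector_mul_assoc[symmetric])

text \<open>Ping-pong on the first basis vector. A product that starts in \<open>H\<close> moves its
  first coordinate, equal to 1, out of \<open>V\<close>; a further letter from \<open>G\<close> on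
  the left cannot bring it back.\<close>

theorem amalgam_injective:
  assumes "amalgamated G H C SO3 f g \<rho> \<sigma>" and inj: "inj_on \<rho> (carrier G)"
    and letG: "\<And>x. x \<in> carrier G - f ` carrier C \<Longrightarrow>
      \<exists>n t. \<exists>D\<in>{mat 1, Rz pi}. 0 < n \<and> cis t ^ n = 1 \<and> sin t \<noteq> 0 \<and> \<rho> x = Rx t ** D"
    and letH: "\<And>y. y \<in> carrier H - g ` carrier C \<Longrightarrow>
      \<exists>n t. \<exists>D\<in>{mat 1, Rx pi}. 0 < n \<and> cis t ^ n = 1 \<and> sin t \<noteq> 0 \<and> cos t \<noteq> 0 \<and> \<sigma> y = Rz t ** D"
  shows "inj_on (amalgamated.\<Phi> SO3 \<rho> \<sigma>) (carrier (amalgam G H C f g))"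
proof -
  interpret amalgamated G H C SO3 f g \<rho> \<sigma> by fact
  let ?e = "axis 1 1 :: real ^ 3"
  have H: "afterZ (\<sigma> y *v v)" if "y \<in> carrier H - g ` carrier C" "beforeZ v" for y v
    using letH[OF that(1)] afterZ_letter that(2) by metis
  have G: "beforeZ (\<rho> x *v v) \<and> (\<rho> x *v v) $ 1 \<notin> V"
    if "x \<in> carrier G - f ` carrier C" "afterZ v" for x v
    using letG[OF that(1)] beforeZ_letter first_coordinate_letter that(2) by metis
  have e: "beforeZ ?e" using beforeZ_axis[of "mat 1" 0] by simp
  have e': "beforeZ (\<rho> x *v ?e)" if "x \<in> carrier G - f ` carrier C" for x
    using letG[OF that] beforeZ_axis by metis
  have V1: "?e $ 1 \<in> V" using closed(1) by (simp add: axis_def)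
  show ?thesis
  proof (rule \<Phi>_inj[where P = "\<lambda>k. afterZ (k *v ?e)", OF inj])
    fix k assume "afterZ (k *v ?e)"
    then show "k \<noteq> \<one>\<^bsub>SO3\<^esub>" using V1 by (auto simp: afterZ_def stateZ_def)
    fix x assume "x \<in> carrier G - f ` carrier C"
    then have "(\<rho> x *v (k *v ?e)) $ 1 \<notin> V" using G \<open>afterZ (k *v ?e)\<close> by blast
    then show "\<rho> x \<otimes>\<^bsub>SO3\<^esub> k \<noteq> \<one>\<^bsub>SO3\<^esub>"
      using V1 by (metis SO3_simps matrix_vector_mul_assoc matrix_vector_mul_lid)
  qed (simp_all add: H G e e' matrix_vector_mul_assoc[symmetric])
qed

end

text \<open>The image of \<open>\<Phi>\<close> is the generated group: it contains both rotations by
  \<open>A\<close> and \<open>B\<close>, and \<open>image\<close>, applied to the generated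
  subgroup, gives the other inclusion.\<close>

lemma rotgrp_iso_amalgam:
  assumes "amalgamated G H C SO3 f g \<rho> \<sigma>" and inj: "inj_on \<rho> (carrier G)"
    and A: "Rx (2 * pi / real p) \<in> \<rho> ` carrier G" and B: "Rz (2 * pi / real q) \<in> \<sigma> ` carrier H"
    and image: "\<And>S. subgroup S SO3 \<Longrightarrow> Rx (2 * pi / real p) \<in> S \<Longrightarrow> Rz (2 * pi / real q) \<in> S \<Longrightarrow>
      \<rho> ` carrier G \<subseteq> S \<and> \<sigma> ` carrier H \<subseteq> S"
    and letG: "\<And>x. x \<in> carrier G - f ` carrier C \<Longrightarrow>
      \<exists>n t. \<exists>D\<in>{mat 1, Rz pi}. 0 < n \<and> cis t ^ n = 1 \<and> sin t \<noteq> 0 \<and> \<rho> x = Rx t ** D"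
    and letH: "\<And>y. y \<in> carrier H - g ` carrier C \<Longrightarrow>
      \<exists>n t. \<exists>D\<in>{mat 1, Rx pi}. 0 < n \<and> cis t ^ n = 1 \<and> sin t \<noteq> 0 \<and> cos t \<noteq> 0 \<and> \<sigma> y = Rz t ** D"
  shows "rotgrp p q \<cong> amalgam G H C f g"
proof -
  interpret amalgamated G H C SO3 f g \<rho> \<sigma> by fact
  obtain V where V: "dyadic V"
    using real_valuation_ring by (metis dyadic.intro dyadic_axioms.intro)
  have inj\<Phi>: "inj_on \<Phi> (carrier \<Gamma>)"
    by (rule dyadic.amalgam_injective[OF V assms(1) inj letG letH])
  let ?AB = "{Rx (2 * pi / real p), Rz (2 * pi / real q)}"
  have AB: "?AB \<subseteq> carrier SO3" using Rx_in_SO3 Rz_in_SO3 by auto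
  \<comment> \<open>\<open>subgroup_generated\<close> intersects the generating set with the
    carrier, which changes nothing here.\<close>
  have carr: "carrier (rotgrp p q) = generate SO3 ?AB"
    using AB by (simp add: rotgrp_def carrier_subgroup_generated Int_absorb1)
  have S: "subgroup (generate SO3 ?AB) SO3" by (rule K.generate_is_subgroup[OF AB])
  have "?AB \<subseteq> generate SO3 ?AB" by (auto intro: generate.incl)
  then have "\<rho> ` carrier G \<subseteq> generate SO3 ?AB" "\<sigma> ` carrier H \<subseteq> generate SO3 ?AB"
    using image[OF S] by auto
  then have "\<Phi> ` carrier \<Gamma> \<subseteq> generate SO3 ?AB"
    using \<Phi>_image_subgroup[OF S] by blast
  moreover have "generate SO3 ?AB \<subseteq> \<Phi> ` carrier \<Gamma>"
  proof (rule K.generate_subgroup_incl[OF _ \<Phi>.img_is_subgroup])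
    obtain x y where "x \<in> carrier G" "Rx (2 * pi / real p) = \<Phi> (inG x)"
      "y \<in> carrier H" "Rz (2 * pi / real q) = \<Phi> (inH y)" using A B by auto
    then show "?AB \<subseteq> \<Phi> ` carrier \<Gamma>" using inG_closed inH_closed by blast
  qed
  ultimately have "bij_betw \<Phi> (carrier \<Gamma>) (carrier (rotgrp p q))"
    using inj\<Phi> carr by (auto simp: bij_betw_def)
  moreover have "\<Phi> \<in> hom \<Gamma> (rotgrp p q)"
    using \<open>\<Phi> ` carrier \<Gamma> \<subseteq> generate SO3 ?AB\<close> \<Phi>_hom carr by (auto simp: hom_def rotgrp_def)
  ultimately have "\<Gamma> \<cong> rotgrp p q" by (intro is_isoI isoI) auto
  then show ?thesis by (rule \<Gamma>.iso_sym)
qed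

section \<open>Embeddings of the amalgamated subgroup and the letters outside it\<close>

lemma mon_of_comp:
  assumes "F \<in> hom C K" "\<And>c. c \<in> carrier C \<Longrightarrow> h (F c) = k c" "inj_on k (carrier C)"
  shows "F \<in> mon C K"
proof -
  have "inj_on F (carrier C)"
    using assms(2,3) by (auto simp: inj_on_def) metis
  then show ?thesis using assms(1) by (simp add: mon_def)
qed

text \<open>Faithfulness of \<open>h\<close> shows that \<open>r\<close> squares to one. The
  composite with \<open>h\<close> is the same half-turn representation whatever \<open>K\<close> is,
  which makes \<open>F\<close> injective and makes the embeddings into the two factors
  compatible.\<close>

lemma cyc_2_embedding:
  assumes "group K" and h: "h \<in> hom K SO3" "inj_on h (carrier K)"
    and r: "r \<in> carrier K" "h r = Rx pi"
  obtains F where "F \<in> mon (cyc 2) K" "F (cyc_gen 2) = r"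
    "\<And>c. c \<in> carrier (cyc 2) \<Longrightarrow> h (F c) = cyc_hom SO3 (Rx pi) c"
proof -
  interpret K: group K by fact
  have ker: "x = \<one>\<^bsub>K\<^esub>" if "x \<in> carrier K" "h x = mat 1" for x
    using that inj_on_one_iff'[OF h(1) K.is_group group_SO3] h(2) by simp
  have "r [^]\<^bsub>K\<^esub> (2::nat) = \<one>\<^bsub>K\<^esub>"
    using hom_nat_pow[OF h(1) r(1) K.is_group group_SO3, of 2] r by (intro ker) (simp_all add: Rx_pow)
  note F = K.cyc_hom[OF r(1) this]
  note T = cyc_rep[of 2]
  have eq: "h (cyc_hom K r c) = cyc_hom SO3 (Rx pi) c" if "c \<in> carrier (cyc 2)" for c
    using cyc_hom_eqI[of SO3 "h \<circ> cyc_hom K r" 2 "cyc_hom SO3 (Rx pi)" c]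
      hom_compose[OF F(1) h(1)] F(2) T(1,2) r that group_SO3 by simp
  show ?thesis
    using that mon_of_comp[where h = h, OF F(1) eq] F(2) eq T(4) by simp
qed

text \<open>The analogue with D_2 realised as the Klein four-group of half turns about the
  coordinate axes.\<close>

lemma dih_2_embedding:
  assumes "group K" and h: "h \<in> hom K SO3" "inj_on h (carrier K)"
    and r: "r \<in> carrier K" "h r = Rx pi" and s: "s \<in> carrier K" "h s = Rz pi"
  obtains F where "F \<in> mon (dih 2) K" "F (dih_rot 2) = r" "F (dih_refl 2) = s"
    "\<And>c. c \<in> carrier (dih 2) \<Longrightarrow> h (F c) = dih_hom SO3 (Rx pi) (Rz pi) c"
proof -
  interpret K: group K by fact
  have ker: "x = \<one>\<^bsub>K\<^esub>" if "x \<in> carrier K" "h x = mat 1" for x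
    using that inj_on_one_iff'[OF h(1) K.is_group group_SO3] h(2) by simp
  have rr: "r [^]\<^bsub>K\<^esub> (2::nat) = \<one>\<^bsub>K\<^esub>"
    using hom_nat_pow[OF h(1) r(1) K.is_group group_SO3, of 2] r by (intro ker) (simp_all add: Rx_pow)
  have ss: "s \<otimes>\<^bsub>K\<^esub> s = \<one>\<^bsub>K\<^esub>"
    using s by (intro ker) (simp_all add: hom_mult[OF h(1)] Rz_add)
  have rs: "s \<otimes>\<^bsub>K\<^esub> (r \<otimes>\<^bsub>K\<^esub> (s \<otimes>\<^bsub>K\<^esub> r)) = \<one>\<^bsub>K\<^esub>"
    using r s by (intro ker) (simp_all add: hom_mult[OF h(1)] Rz_pi_conj)
  note F = K.dih_hom[OF r(1) rr s(1) ss rs]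
  note T = dih_rep[of 2 "(Rx, Rz)"]
  have eq: "h (dih_hom K r s c) = dih_hom SO3 (Rx pi) (Rz pi) c" if "c \<in> carrier (dih 2)" for c
    using dih_hom_eqI[of SO3 "h \<circ> dih_hom K r s" 2 "dih_hom SO3 (Rx pi) (Rz pi)" c]
      hom_compose[OF F(1) h(1)] F(2,3) T(1,2,6) r s that group_SO3 by simp
  show ?thesis
    using that mon_of_comp[where h = h, OF F(1) eq] F(2,3) eq T(4) by simp
qed

text \<open>\<open>S\<close> is meant to be the amalgamated subgroup. As it contains the reflection,
  r^a s is outside only if r^a is, and then \<open>rot\<close> excludes full and half turns.\<close>

lemma dih_letters:
  assumes n: "0 < n" and Ra: "Ra \<in> {(Rx, Rz), (Rz, Rx)}"
    and S: "subgroup S (dih n)" "dih_refl n \<in> S"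
    and rot: "\<And>a::nat. sin (real a * (2 * pi / real n)) = 0 \<Longrightarrow> dih_rot n [^]\<^bsub>dih n\<^esub> a \<in> S"
    and x: "x \<in> carrier (dih n) - S"
  shows "\<exists>t. \<exists>D\<in>{mat 1, snd Ra pi}. cis t ^ n = 1 \<and> sin t \<noteq> 0 \<and>
    dih_hom SO3 (fst Ra (2 * pi / real n)) (snd Ra pi) x = fst Ra t ** D"
proof -
  interpret D: group "dih n" by (rule group_dih)
  note rep = dih_rep[OF n Ra]
  have pow: "dih_rot n [^]\<^bsub>dih n\<^esub> (a::nat) \<in> carrier (dih n)" for a by simp
  from x have "x \<in> carrier (dih n)" by simp
  from dih_cases[OF n this] show ?thesis
  proof cases
    case (1 a)
    then have "sin (real a * (2 * pi / real n)) \<noteq> 0" using rot x by blast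
    then show ?thesis
      using 1 rep(3)[of a] cis_rational[OF n, of a] matrix_mul_rid by (metis insertI1)
  next
    case (2 a)
    then have "sin (real a * (2 * pi / real n)) \<noteq> 0"
      using rot x S subgroup.m_closed by fastforce
    moreover have "dih_hom SO3 (fst Ra (2 * pi / real n)) (snd Ra pi) x =
        fst Ra (real a * (2 * pi / real n)) ** snd Ra pi"
      unfolding 2 by (subst hom_mult[OF rep(1) pow dih_refl_closed]) (simp only: rep SO3_simps)
    ultimately show ?thesis using cis_rational[OF n, of a] by blast
  qed
qed

text \<open>A quarter turn has (cis t)^2 = - 1, and an odd power of that is not 1. This is where 4
  not dividing \<open>q\<close> enters.\<close>

lemma cos_neq_0_order:
  assumes "odd s" "cis t ^ (2 * s) = 1"
  shows "cos t \<noteq> 0"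
proof
  assume c: "cos t = 0"
  have "(sin t)\<^sup>2 = 1" using sin_cos_squared_add[of t] c by simp
  then have "(cis t)\<^sup>2 = - 1" using c by (simp add: complex_eq_iff power2_eq_square)
  then show False using assms by (simp add: power_mult)
qed

lemma half_period: "even p \<Longrightarrow> 0 < p \<Longrightarrow> real (p div 2) * (2 * pi / real p) = pi"
  by (auto elim!: evenE)

lemma injective_pow_eq:
  assumes "inj_on h (carrier K)" "group K" "h \<in> hom K SO3" "x \<in> carrier K" "y \<in> carrier K"
    and "h x = mat 1 \<or> h x = h y"
  shows "x = \<one>\<^bsub>K\<^esub> \<or> x = y"
  using assms inj_on_one_iff'[OF assms(3,2) group_SO3] by (auto dest: inj_onD)

lemma rotgrp_odd:
  assumes p: "even p" "0 < p" and q: "odd q"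
  shows "\<exists>f g. f \<in> mon (cyc 2) (cyc p) \<and> g \<in> mon (cyc 2) (dih q) \<and>
    f (cyc_gen 2) = cyc_gen p [^]\<^bsub>cyc p\<^esub> (p div 2) \<and> g (cyc_gen 2) = dih_refl q \<and>
    rotgrp p q \<cong> amalgam (cyc p) (dih q) (cyc 2) f g"
proof -
  interpret CP: group "cyc p" by (rule group_cyc)
  interpret DQ: group "dih q" by (rule group_dih)
  have q0: "0 < q" using q by (auto intro: Nat.gr0I)
  define \<rho> where "\<rho> = cyc_hom SO3 (Rx (2 * pi / real p))"
  define \<sigma> where "\<sigma> = dih_hom SO3 (Rz (2 * pi / real q)) (Rx pi)"
  note rep\<rho> = cyc_rep[OF p(2), folded \<rho>_def]
  note rep\<sigma> = dih_rep[OF q0, of "(Rz, Rx)", simplified, folded \<sigma>_def]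
  let ?z = "cyc_gen p [^]\<^bsub>cyc p\<^esub> (p div 2)"
  have z: "?z \<in> carrier (cyc p)" "\<rho> ?z = Rx pi"
    using rep\<rho>(3)[of "p div 2"] half_period[OF p] by simp_all
  obtain f where emb_f: "f \<in> mon (cyc 2) (cyc p)" "f (cyc_gen 2) = ?z"
    "\<And>c. c \<in> carrier (cyc 2) \<Longrightarrow> \<rho> (f c) = cyc_hom SO3 (Rx pi) c"
    using cyc_2_embedding[OF group_cyc rep\<rho>(1,4) z] by blast
  obtain g where emb_g: "g \<in> mon (cyc 2) (dih q)" "g (cyc_gen 2) = dih_refl q"
    "\<And>c. c \<in> carrier (cyc 2) \<Longrightarrow> \<sigma> (g c) = cyc_hom SO3 (Rx pi) c"
    using cyc_2_embedding[OF group_dih rep\<sigma>(1,4) dih_refl_closed rep\<sigma>(2)] by blast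
  have am: "amalgamated (cyc p) (dih q) (cyc 2) SO3 f g \<rho> \<sigma>"
    using emb_f emb_g rep\<rho>(1) rep\<sigma>(1)
    by (auto simp: amalgamated_def amalgamated_axioms_def group_cyc group_dih group_SO3 mon_def)
  interpret amalgamated "cyc p" "dih q" "cyc 2" SO3 f g \<rho> \<sigma> by (rule am)
  have "rotgrp p q \<cong> amalgam (cyc p) (dih q) (cyc 2) f g"
  proof (rule rotgrp_iso_amalgam[OF am rep\<rho>(4)])
    show "Rx (2 * pi / real p) \<in> \<rho> ` carrier (cyc p)"
      using rep\<rho>(2) by (metis cyc_gen_closed imageI)
    show "Rz (2 * pi / real q) \<in> \<sigma> ` carrier (dih q)"
      using rep\<sigma>(6) by (metis dih_rot_closed imageI)
    show "\<rho> ` carrier (cyc p) \<subseteq> S \<and> \<sigma> ` carrier (dih q) \<subseteq> S"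
      if S: "subgroup S SO3" "Rx (2 * pi / real p) \<in> S" "Rz (2 * pi / real q) \<in> S" for S
    proof -
      have "\<rho> ` carrier (cyc p) \<subseteq> S"
        unfolding \<rho>_def using p(2)
        by (intro K.cyc_hom(3)[OF Rx_in_SO3 _ S(1,2)]) (simp add: Rx_pow)
      moreover from this have "Rx pi \<in> S" using z by (metis image_subset_iff)
      ultimately show ?thesis using rep\<sigma>(5)[OF S(1,3)] by simp
    qed
  next
    fix x assume x: "x \<in> carrier (cyc p) - f ` carrier (cyc 2)"
    then obtain a :: nat where a: "x = cyc_gen p [^]\<^bsub>cyc p\<^esub> a" using cyc_cases[OF p(2)] by blast
    let ?t = "real a * (2 * pi / real p)"
    have "sin ?t \<noteq> 0"
    proof
      \<comment> \<open>Then the rotation is trivial or the half turn, so by faithfulness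
        \<open>x\<close> is one or \<open>?z\<close>, both in the amalgamated subgroup.\<close>
      assume "sin ?t = 0"
      then have "x = \<one>\<^bsub>cyc p\<^esub> \<or> x = ?z"
        using injective_pow_eq[OF rep\<rho>(4) group_cyc rep\<rho>(1), of x ?z] Rx_sin_0[of ?t] rep\<rho>(3)[of a] a x z
        by auto
      moreover have "\<one>\<^bsub>cyc p\<^esub> = f \<one>\<^bsub>cyc 2\<^esub>" "?z = f (cyc_gen 2)" using emb_f(2) by simp_all
      ultimately show False using x C.one_closed cyc_gen_closed by blast
    qed
    then show "\<exists>n t. \<exists>D\<in>{mat 1, Rz pi}. 0 < n \<and> cis t ^ n = 1 \<and> sin t \<noteq> 0 \<and> \<rho> x = Rx t ** D"
      using cis_rational[OF p(2)] rep\<rho>(3)[of a] p(2) unfolding a by (metis insertI1 matrix_mul_rid)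
  next
    fix y assume y: "y \<in> carrier (dih q) - g ` carrier (cyc 2)"
    have "dih_refl q \<in> g ` carrier (cyc 2)" using emb_g(2) by (metis cyc_gen_closed imageI)
    moreover have "dih_rot q [^]\<^bsub>dih q\<^esub> a \<in> g ` carrier (cyc 2)"
      if "sin (real a * (2 * pi / real q)) = 0" for a :: nat
    proof -
      let ?t = "real a * (2 * pi / real q)"
      \<comment> \<open>For odd \<open>q\<close> a half turn is impossible, since (- 1)^q is not
        1.\<close>
      have "cos ?t = 1"
      proof (rule ccontr)
        assume "cos ?t \<noteq> 1"
        then have "cis ?t = - 1" using that sin_0_imp[OF that] by (simp add: complex_eq_iff)
        then show False using cis_rational[OF q0, of a] q by simp
      qed
      then have "Rz ?t = mat 1" using Rz_cong[of ?t 0] that by simp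
      then have "dih_rot q [^]\<^bsub>dih q\<^esub> a = \<one>\<^bsub>dih q\<^esub>"
        using injective_pow_eq[OF rep\<sigma>(4) group_dih rep\<sigma>(1), of "dih_rot q [^]\<^bsub>dih q\<^esub> a" "\<one>\<^bsub>dih q\<^esub>"]
          rep\<sigma>(3)[of a] by simp
      then show ?thesis using g.hom_one C.one_closed by (metis imageI)
    qed
    ultimately have "\<exists>t. \<exists>D\<in>{mat 1, Rx pi}. cis t ^ q = 1 \<and> sin t \<noteq> 0 \<and> \<sigma> y = Rz t ** D"
      using dih_letters[OF q0, of "(Rz, Rx)", OF _ g.img_is_subgroup _ _ y] unfolding \<sigma>_def by simp
    then obtain t D where t: "D \<in> {mat 1, Rx pi}" "cis t ^ q = 1" "sin t \<noteq> 0" "\<sigma> y = Rz t ** D"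
      by blast
    then have "cis t ^ (2 * q) = 1" by (simp add: mult.commute power_mult)
    then have "cos t \<noteq> 0" using cos_neq_0_order q by blast
    then show "\<exists>n t. \<exists>D\<in>{mat 1, Rx pi}. 0 < n \<and> cis t ^ n = 1 \<and> sin t \<noteq> 0 \<and> cos t \<noteq> 0 \<and> \<sigma> y = Rz t ** D"
      using t q0 by blast
  qed
  then show ?thesis using emb_f emb_g by blast
qed

text \<open>The matching is dictated by the half turns: \<open>Rx pi\<close> is a power of the
  rotation in D_p but the reflection in D_q, and \<open>Rz pi\<close> the reverse. So
  \<open>g\<close> exchanges the roles of the two generators of D_2.\<close>

lemma rotgrp_even:
  assumes p: "even p" "0 < p" and q: "q = 2 * s" "odd s"
  shows "\<exists>f g. f \<in> mon (dih 2) (dih p) \<and> g \<in> mon (dih 2) (dih q) \<and>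
    f (dih_refl 2) = dih_refl p \<and> f (dih_rot 2) = dih_rot p [^]\<^bsub>dih p\<^esub> (p div 2) \<and>
    g (dih_refl 2) = dih_rot q [^]\<^bsub>dih q\<^esub> (q div 2) \<and> g (dih_rot 2) = dih_refl q \<and>
    rotgrp p q \<cong> amalgam (dih p) (dih q) (dih 2) f g"
proof -
  interpret DP: group "dih p" by (rule group_dih)
  interpret DQ: group "dih q" by (rule group_dih)
  have q0: "even q" "0 < q" using q by (auto intro: Nat.gr0I)
  define \<rho> where "\<rho> = dih_hom SO3 (Rx (2 * pi / real p)) (Rz pi)"
  define \<sigma> where "\<sigma> = dih_hom SO3 (Rz (2 * pi / real q)) (Rx pi)"
  note rep\<rho> = dih_rep[OF p(2), of "(Rx, Rz)", simplified, folded \<rho>_def]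
  note rep\<sigma> = dih_rep[OF q0(2), of "(Rz, Rx)", simplified, folded \<sigma>_def]
  let ?zp = "dih_rot p [^]\<^bsub>dih p\<^esub> (p div 2)" and ?zq = "dih_rot q [^]\<^bsub>dih q\<^esub> (q div 2)"
  have zp: "?zp \<in> carrier (dih p)" "\<rho> ?zp = Rx pi"
    using rep\<rho>(3)[of "p div 2"] half_period[OF p] by simp_all
  have zq: "?zq \<in> carrier (dih q)" "\<sigma> ?zq = Rz pi"
    using rep\<sigma>(3)[of "q div 2"] half_period[OF q0] by simp_all
  obtain f where emb_f: "f \<in> mon (dih 2) (dih p)" "f (dih_rot 2) = ?zp" "f (dih_refl 2) = dih_refl p"
    "\<And>c. c \<in> carrier (dih 2) \<Longrightarrow> \<rho> (f c) = dih_hom SO3 (Rx pi) (Rz pi) c"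
    using dih_2_embedding[OF group_dih rep\<rho>(1,4) zp dih_refl_closed rep\<rho>(2)] by blast
  obtain g where emb_g: "g \<in> mon (dih 2) (dih q)" "g (dih_rot 2) = dih_refl q" "g (dih_refl 2) = ?zq"
    "\<And>c. c \<in> carrier (dih 2) \<Longrightarrow> \<sigma> (g c) = dih_hom SO3 (Rx pi) (Rz pi) c"
    using dih_2_embedding[OF group_dih rep\<sigma>(1,4) dih_refl_closed rep\<sigma>(2) zq] by blast
  have am: "amalgamated (dih p) (dih q) (dih 2) SO3 f g \<rho> \<sigma>"
    using emb_f emb_g rep\<rho>(1) rep\<sigma>(1)
    by (auto simp: amalgamated_def amalgamated_axioms_def group_dih group_SO3 mon_def)
  interpret amalgamated "dih p" "dih q" "dih 2" SO3 f g \<rho> \<sigma> by (rule am)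
  have "rotgrp p q \<cong> amalgam (dih p) (dih q) (dih 2) f g"
  proof (rule rotgrp_iso_amalgam[OF am rep\<rho>(4)])
    show "Rx (2 * pi / real p) \<in> \<rho> ` carrier (dih p)"
      using rep\<rho>(6) by (metis dih_rot_closed imageI)
    show "Rz (2 * pi / real q) \<in> \<sigma> ` carrier (dih q)"
      using rep\<sigma>(6) by (metis dih_rot_closed imageI)
    show "\<rho> ` carrier (dih p) \<subseteq> S \<and> \<sigma> ` carrier (dih q) \<subseteq> S"
      if S: "subgroup S SO3" "Rx (2 * pi / real p) \<in> S" "Rz (2 * pi / real q) \<in> S" for S
    proof -
      \<comment> \<open>Both half turns are powers of the two given rotations, because
        \<open>p\<close> and \<open>q\<close> are even.\<close>
      have pow: "r [^]\<^bsub>SO3\<^esub> (n::nat) \<in> S" if "r \<in> S" for r n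
        using that S(1) by (induction n) (auto intro: subgroup.one_closed subgroup.m_closed simp del: SO3_simps)
      have "Rx pi \<in> S" using pow[OF S(2), of "p div 2"] half_period[OF p] by (simp add: Rx_pow)
      moreover have "Rz pi \<in> S" using pow[OF S(3), of "q div 2"] half_period[OF q0] by (simp add: Rz_pow)
      ultimately show ?thesis using rep\<rho>(5)[OF S(1,2)] rep\<sigma>(5)[OF S(1,3)] by simp
    qed
  next
    fix x assume x: "x \<in> carrier (dih p) - f ` carrier (dih 2)"
    have im: "\<one>\<^bsub>dih p\<^esub> \<in> f ` carrier (dih 2)" "?zp \<in> f ` carrier (dih 2)"
      "dih_refl p \<in> f ` carrier (dih 2)"
      using emb_f(2,3) f.hom_one C.one_closed dih_rot_closed dih_refl_closed by (metis imageI)+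
    have "dih_rot p [^]\<^bsub>dih p\<^esub> a \<in> f ` carrier (dih 2)"
      if "sin (real a * (2 * pi / real p)) = 0" for a :: nat
      using injective_pow_eq[OF rep\<rho>(4) group_dih rep\<rho>(1), of "dih_rot p [^]\<^bsub>dih p\<^esub> a" ?zp]
        Rx_sin_0[OF that] rep\<rho>(3)[of a] zp im by auto
    then show "\<exists>n t. \<exists>D\<in>{mat 1, Rz pi}. 0 < n \<and> cis t ^ n = 1 \<and> sin t \<noteq> 0 \<and> \<rho> x = Rx t ** D"
      using dih_letters[OF p(2), of "(Rx, Rz)", OF _ f.img_is_subgroup im(3) _ x] p(2)
      unfolding \<rho>_def by auto
  next
    fix y assume y: "y \<in> carrier (dih q) - g ` carrier (dih 2)"
    have im: "\<one>\<^bsub>dih q\<^esub> \<in> g ` carrier (dih 2)" "?zq \<in> g ` carrier (dih 2)"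
      "dih_refl q \<in> g ` carrier (dih 2)"
      using emb_g(2,3) g.hom_one C.one_closed dih_rot_closed dih_refl_closed by (metis imageI)+
    have "dih_rot q [^]\<^bsub>dih q\<^esub> a \<in> g ` carrier (dih 2)"
      if "sin (real a * (2 * pi / real q)) = 0" for a :: nat
      using injective_pow_eq[OF rep\<sigma>(4) group_dih rep\<sigma>(1), of "dih_rot q [^]\<^bsub>dih q\<^esub> a" ?zq]
        Rz_sin_0[OF that] rep\<sigma>(3)[of a] zq im by auto
    then have "\<exists>t. \<exists>D\<in>{mat 1, Rx pi}. cis t ^ q = 1 \<and> sin t \<noteq> 0 \<and> \<sigma> y = Rz t ** D"
      using dih_letters[OF q0(2), of "(Rz, Rx)", OF _ g.img_is_subgroup im(3) _ y]
      unfolding \<sigma>_def by simp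
    then obtain t D where t: "D \<in> {mat 1, Rx pi}" "cis t ^ q = 1" "sin t \<noteq> 0" "\<sigma> y = Rz t ** D"
      by blast
    then have "cos t \<noteq> 0" using cos_neq_0_order q by blast
    then show "\<exists>n t. \<exists>D\<in>{mat 1, Rx pi}. 0 < n \<and> cis t ^ n = 1 \<and> sin t \<noteq> 0 \<and> cos t \<noteq> 0 \<and> \<sigma> y = Rz t ** D"
      using t q0 by blast
  qed
  then show ?thesis using emb_f emb_g by blast
qed

theorem corollary2:
  fixes p q :: nat
  assumes "even p" and "4 \<le> p"
  shows "(odd q \<and> 3 \<le> q \<longrightarrow>
      (\<exists>f g. f \<in> mon (cyc 2) (cyc p) \<and> g \<in> mon (cyc 2) (dih q) \<and>
        f (cyc_gen 2) = cyc_gen p [^]\<^bsub>cyc p\<^esub> (p div 2) \<and>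
        g (cyc_gen 2) = dih_refl q \<and>
        rotgrp p q \<cong> amalgam (cyc p) (dih q) (cyc 2) f g)) \<and>
    (\<forall>s. q = 2 * s \<and> odd s \<and> 3 \<le> s \<longrightarrow>
      (\<exists>f g. f \<in> mon (dih 2) (dih p) \<and> g \<in> mon (dih 2) (dih q) \<and>
        f (dih_refl 2) = dih_refl p \<and>
        f (dih_rot 2) = dih_rot p [^]\<^bsub>dih p\<^esub> (p div 2) \<and>
        g (dih_refl 2) = dih_rot q [^]\<^bsub>dih q\<^esub> (q div 2) \<and>
        g (dih_rot 2) = dih_refl q \<and>
        rotgrp p q \<cong> amalgam (dih p) (dih q) (dih 2) f g))"
proof -
  have p: "0 < p" using assms by simp
  show ?thesis
    by (intro conjI impI allI; elim conjE)
      (rule rotgrp_odd[OF assms(1) p], assumption, rule rotgrp_even[OF assms(1) p], assumption+)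
qed

end
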